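(* Let $\mathfrak P$ be a Laurent differentially essential and super essential system of sparse generic Laurent differential polynomials, and let $l\in\{1,\dots,L\}$ with $D_l(\mathfrak P)\neq0$. Let $H_0$ be the output of the specialization algorithm with $D_l(\mathfrak P)$ as input, and let $\mathcal H$ be the set of irreducible factors $H$ of $H_0$ in $\mathfrak D$ with $H(\zeta)=0$. If there exists $H\in\mathcal H$ such that $\mathcal I(H)$ has codimension one, then $H_0=\mathfrak E\,\partial\mathrm{Res}(\mathfrak P)$ with $\mathfrak E\in\mathfrak D$.
   Context: Generic system. Let $n\ge2$, $U=\{u_1,\dots,u_{n-1}\}$ differential indeterminates with derivation $\partial$, $u_{j,k}=\partial^ku_j$, $u_{j,0}=u_j$, $0\in\mathbb N$. For each $i=1,\dots,n$ let $M_i,M_{i,1},\dots,M_{i,l_i}$ be distinct Laurent monomials in the $u_{j,k}$, let $A_i=\{\mathfrak a_i,\mathfrak a_{i,1},\dots,\mathfrak a_{i,l_i}\}$ be differential indeterminates over $\mathbb Q$, $A=\bigcup_iA_i$, $\mathfrak D=\mathbb Q\{A\}$, $\mathbb F_i=\mathfrak a_iM_i+\sum_{k=1}^{l_i}\mathfrak a_{i,k}M_{i,k}$ and $\mathfrak P=\{\mathbb F_1,\dots,\mathbb F_n\}\subset\mathfrak D\{U^{\pm}\}=\mathfrak D[u_{j,k}^{\pm1}: 1\le j\le n-1,k\in\mathbb N]$. Each $\mathbb F_i$ involves some $u_{j,k}$, and for each $j$ some $u_{j,k}$ occurs in some $\mathbb F_i$. $[\mathfrak P]$ is the differential ideal generated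 by $\mathfrak P$ in $\mathfrak D\{U^\pm\}$. Put $\zeta_i=-\sum_{k=1}^{l_i}\mathfrak a_{i,k}M_{i,k}/M_i$ and $\zeta=(A\setminus\{\mathfrak a_1,\dots,\mathfrak a_n\};\zeta_1,\dots,\zeta_n)$; $H(\zeta)$ denotes replacing each $\partial^k\mathfrak a_i$ by $\partial^k\zeta_i$ in $H\in\mathfrak D$. For $H\in\mathfrak D$, $\mathrm{ord}(H,A_i)$ is the maximal order of a derivative of an element of $A_i$ occurring in $H$ ($-\infty$ if none). Differential resultant. $\mathfrak P$ is Laurent differentially essential if for each $i$ there is $k_i\in\{1,\dots,l_i\}$ such that the set $\{M_{i,k_i}M_i^{-1}: 1\le i\le n\}$ has differential transcendence degree $n-1$ over $\mathbb Q$. Then $[\mathfrak P]\cap\mathfrak D$ is a prime differential ideal of codimension one equal to $\mathrm{sat}(R)$ for an irreducible $R=\partial\mathrm{Res}(\mathfrak P)\in\mathfrak D$, the sparse differential resultant; $\mathrm{sat}(R)$ is the set of differential polynomials in $\mathfrak D$ with zero differential remainder w.r.t. $R$ under any elimination ranking. Orders. $\mathfrak S_j(f)$ is the set of $k$ such that $u_{j,k}$ occurs in $f$; $o_{i,j}=\max\mathfrak S_j(\mathbb F_i)$ ($-\infty$ if empty). $J_i=\max_\mu\sum_{h\ne i}o_{h,\mu(h)}$ over bijections $\mu:\{1,\dots,n\}\setminus\{i\}\to\{1,\dots,n-1\}$. $\mathfrak P$ is super essential if $J_i\ge0$ for all $i$. $\gamma_j=\min\bigcup_i\mathfrak S_j(\mathbb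 F_i)$, $\gamma=\sum_j\gamma_j$, $M'_j=\max_i\{o_{i,j}+J_i\}-\gamma$. Put $\mathrm{ps}(\mathfrak P)=\{\partial^k\mathbb F_i: 1\le i\le n,\ 0\le k\le J_i-\gamma\}$, $L=\sum_i(J_i-\gamma+1)=|\mathrm{ps}(\mathfrak P)|$, $\mathcal V(\mathfrak P)=\{u_{j,k}:\gamma_j\le k\le M'_j\}$, of cardinality $L-1$. Algebraic generic system. Fix bijections $\lambda:\mathrm{ps}(\mathfrak P)\to\{1,\dots,L\}$, $\rho=\lambda^{-1}$, and $\upsilon:\mathcal Y=\{y_1,\dots,y_{L-1}\}\to\mathcal V(\mathfrak P)$ ($y_h$ algebraic indeterminates), extended to Laurent monomials. $\mathcal A(f)\subset\mathbb Z^{L-1}$ is the set of $\alpha$ such that $\upsilon(y^\alpha)$ has nonzero coefficient in $f$. With algebraic indeterminates $c^h_\alpha$ over $\mathbb Q$, put $P_h=\sum_{\alpha\in\mathcal A(\rho(h))}c^h_\alpha y^\alpha$, $\mathrm{ags}(\mathfrak P)=\{P_1,\dots,P_L\}$, $\mathcal C_h=\{c_\alpha^h\}_\alpha$, $\mathcal C=\bigcup_h\mathcal C_h$. The specialization $\Xi:\mathbb Q[\mathcal C][\mathcal Y^\pm]\to\mathfrak D\{U^\pm\}$ is the ring homomorphism sending $c^h_\alpha$ to the coefficient of $\upsilon(y^\alpha)$ in $\rho(h)$ and $y_h$ to $\upsilon(y_h)$. It is assumed that $M_i$ is such that, for $\rho(h)=\partial^k\mathbb F_i\in\mathrm{ps}(\mathfrak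 P)$, the coefficient in $\mathcal C_h$ of the monomial corresponding to $M_i$ is specialized by $\Xi$ to $\partial^k\mathfrak a_i$. Sylvester determinants (Canny–Emiris construction). Let $Q_h$ be the convex hull of $\mathcal A(\rho(h))$, $N=Q_1+\dots+Q_L$, and $\mathcal L$ the affine lattice generated by the Minkowski sum $\sum_h\mathcal A(\rho(h))$. Sufficiently generic linear liftings of $Q_1,\dots,Q_L$ define, by projecting the lower envelope of the Minkowski sum of the lifted polytopes, a mixed subdivision of $N$ whose maximal cells are written $F_1+\dots+F_L$, $F_h$ a face of $Q_h$, $\sum_h\dim F_h=\dim N$. Choose a small generic vector $\delta$ parallel to the affine span of $N$ with $\mathcal E=\mathcal L\cap(N+\delta)\ne\emptyset$. For $p\in\mathcal E$ let $F_1+\dots+F_L$ be the maximal cell with $p-\delta$ in its relative interior; let $h(p)$ be the largest index $h$ with $F_h=\{a(p)\}$ a vertex, for a total order of the indices in which $l$ is the smallest. $S_l(\mathfrak P)$ is the square matrix indexed by $\mathcal E\times\mathcal E$ whose row $p$ lists the coefficients of $y^{p-a(p)}P_{h(p)}$ in the monomials $y^q$, $q\in\mathcal E$; $D_l(\mathfrak P)=\det S_l(\mathfrak P)\in\mathbb Q[\mathcal C]$. Specialization algorithm. Input: a nonzero $Q$ in $\mathbb Q[\mathcal C]$ belonging to the ideal generated by $\mathrm{ags}(\mathfrak P)$ in $\mathbb Q[\mathcal C][\mathcal Y^\pm]$. Start with $\Delta=\emptyset$, $H=Q$. While $\Delta\ne\mathcal C$: choose $c\in\mathcal C\setminus\Delta$,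 add $c$ to $\Delta$; if substituting $c\mapsto\Xi(c)$ in $H$ gives a nonzero polynomial, replace $H$ by it; otherwise write $H=(c-\Xi(c))^s\overline H$ with $s\ge1$ and $\overline H|_{c=\Xi(c)}\ne0$, and replace $H$ by $\overline H|_{c=\Xi(c)}$. When $\Delta=\mathcal C$, return $H$, an element of $\mathfrak D$. The ideal $\mathcal I(H)$. For $\tau\in(\mathbb N\cup\{-\infty\})^n$ let $\mathrm{PS}(\tau)=\{\partial^k\mathbb F_i:0\le k\le\tau_i\}$ (no $k$ if $\tau_i=-\infty$), $\mathcal V(\tau)=\{u_{j,k}:\gamma_j\le k\le\kappa_j\}$ with $\kappa_j=\max_i\{o_{i,j}+\tau_i\}$, and $A_i^{[\tau_i]}=\bigcup_{k=0}^{\tau_i}\partial^kA_i$ (empty if $\tau_i=-\infty$). For $H\in\mathcal H$ put $\sigma=(\sigma_1,\dots,\sigma_n)$, $\sigma_i=\mathrm{ord}(H,A_i)$, and $\mathcal I(H)=(\mathrm{PS}(\sigma))\cap\mathbb Q[\bigcup_iA_i^{[\sigma_i]}]$, where $(\mathrm{PS}(\sigma))$ is the ideal generated by $\mathrm{PS}(\sigma)$ in $\mathbb Q[\bigcup_iA_i^{[\sigma_i]}][\mathcal V(\sigma)^\pm]$. Codimension is as an ideal of the polynomial ring $\mathbb Q[\bigcup_iA_i^{[\sigma_i]}]$. *)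

theory Defs
  imports
    "HOL-Analysis.Analysis"
    "HOL-Algebra.Ring_Divisibility"
    "HOL-Library.Poly_Mapping"
    "HOL-Library.Set_Algebras"
    "HOL-Library.Extended_Nat"
begin

section \<open>Polynomials and Laurent polynomials\<close>

text \<open>Polynomials are finitely supported functions on exponents \<open>'v \<Rightarrow>\<^sub>0 nat\<close>, Laurent polynomials
  are finitely supported functions on exponents \<open>'v \<Rightarrow>\<^sub>0 int\<close>.\<close>

type_synonym ('v, 'a) mpoly = "('v \<Rightarrow>\<^sub>0 nat) \<Rightarrow>\<^sub>0 'a"
type_synonym ('v, 'a) laurent = "('v \<Rightarrow>\<^sub>0 int) \<Rightarrow>\<^sub>0 'a"

definition mconst :: "'a::zero \<Rightarrow> ('e::zero \<Rightarrow>\<^sub>0 'a)" where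
  "mconst c = Poly_Mapping.single 0 c"

definition mvar :: "'v \<Rightarrow> ('v, 'a::zero_neq_one) mpoly" where
  "mvar v = Poly_Mapping.single (Poly_Mapping.single v 1) 1"

definition mvars :: "(('v \<Rightarrow>\<^sub>0 'e::zero) \<Rightarrow>\<^sub>0 'a::zero) \<Rightarrow> 'v set" where
  "mvars p = (\<Union>m\<in>Poly_Mapping.keys p. Poly_Mapping.keys m)"

definition meval :: "('a::zero \<Rightarrow> 'r::comm_ring_1) \<Rightarrow> ('v \<Rightarrow> 'r) \<Rightarrow> ('v, 'a) mpoly \<Rightarrow> 'r" where
  "meval \<phi> f p = (\<Sum>m\<in>Poly_Mapping.keys p. \<phi> (Poly_Mapping.lookup p m) *
      (\<Prod>v\<in>Poly_Mapping.keys m. f v ^ Poly_Mapping.lookup m v))"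

definition deg_in :: "'v \<Rightarrow> ('v, 'a::zero) mpoly \<Rightarrow> nat" where
  "deg_in v p = Max (insert 0 ((\<lambda>m. Poly_Mapping.lookup m v) ` Poly_Mapping.keys p))"

definition lcoeff_in :: "'v \<Rightarrow> ('v, 'a::comm_ring_1) mpoly \<Rightarrow> ('v, 'a) mpoly" where
  "lcoeff_in v p =
     (\<Sum>m\<in>{m \<in> Poly_Mapping.keys p. Poly_Mapping.lookup m v = deg_in v p}.
        Poly_Mapping.single (m - Poly_Mapping.single v (deg_in v p)) (Poly_Mapping.lookup p m))"

text \<open>A subring of a type-class ring, as a ring record.\<close>

definition subring_on :: "'a::comm_ring_1 set \<Rightarrow> 'a ring" where
  "subring_on S = \<lparr>carrier = S, monoid.mult = (*), one = 1, ring.zero = 0, add = (+)\<rparr>"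

definition poly_ring :: "'v set \<Rightarrow> ('v, 'a::comm_ring_1) mpoly ring" where
  "poly_ring V = subring_on {p. mvars p \<subseteq> V}"

text \<open>\<open>laurent_ring B V\<close> is \<open>B[v\<^sup>\<plusminus>\<^sup>1 : v \<in> V]\<close>.\<close>

definition laurent_ring :: "'a::comm_ring_1 set \<Rightarrow> 'v set \<Rightarrow> ('v, 'a) laurent ring" where
  "laurent_ring B V = subring_on {f. mvars f \<subseteq> V \<and> (\<forall>m. Poly_Mapping.lookup f m \<in> B)}"

text \<open>The height of a prime ideal is the supremum of the lengths of chains of primes ending in it;
  the codimension of an ideal is the least height of a prime containing it.\<close>

definition prime_height :: "('a, 'b) ring_scheme \<Rightarrow> 'a set \<Rightarrow> enat" where
  "prime_height R P =
     (SUP c\<in>{c. c \<noteq> [] \<and> last c = P \<and> sorted_wrt (\<subset>) c \<and> (\<forall>Q\<in>set c. primeideal Q R)}.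
        enat (length c - 1))"

definition codimension :: "('a, 'b) ring_scheme \<Rightarrow> 'a set \<Rightarrow> enat" where
  "codimension R I = (INF P\<in>{P. primeideal P R \<and> I \<subseteq> P}. prime_height R P)"


section \<open>Differential polynomials\<close>

text \<open>\<open>Der x k\<close> is the \<open>k\<close>-th derivative of the differential indeterminate \<open>x\<close>.\<close>

datatype 'x der = Der 'x nat

primrec shift :: "'x der \<Rightarrow> 'x der" where
  "shift (Der x k) = Der x (Suc k)"

definition ders :: "'x set \<Rightarrow> 'x der set" where
  "ders X = {Der x k | x k. x \<in> X}"

definition dp_deriv :: "('x der, 'a::comm_ring_1) mpoly \<Rightarrow> ('x der, 'a) mpoly" where
  \<comment> \<open>the coefficients are constants\<close>
  "dp_deriv p = (\<Sum>m\<in>Poly_Mapping.keys p. \<Sum>v\<in>Poly_Mapping.keys m.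
     Poly_Mapping.single (m - Poly_Mapping.single v 1 + Poly_Mapping.single (shift v) 1)
       (of_nat (Poly_Mapping.lookup m v) * Poly_Mapping.lookup p m))"

text \<open>The derivation on Laurent differential polynomials extending \<open>d\<close> on the coefficients.\<close>

definition dl_deriv ::
  "('a::comm_ring_1 \<Rightarrow> 'a) \<Rightarrow> ('x der, 'a) laurent \<Rightarrow> ('x der, 'a) laurent" where
  "dl_deriv d f = (\<Sum>m\<in>Poly_Mapping.keys f.
     Poly_Mapping.single m (d (Poly_Mapping.lookup f m)) +
     (\<Sum>v\<in>Poly_Mapping.keys m.
        Poly_Mapping.single (m - Poly_Mapping.single v 1 + Poly_Mapping.single (shift v) 1)
          (of_int (Poly_Mapping.lookup m v) * Poly_Mapping.lookup f m)))"

definition diff_ideal :: "'a set \<Rightarrow> 'a ring \<Rightarrow> ('a \<Rightarrow> 'a) \<Rightarrow> bool" where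
  "diff_ideal I R d \<longleftrightarrow> ideal I R \<and> d ` I \<subseteq> I"

definition gen_diff_ideal :: "'a ring \<Rightarrow> ('a \<Rightarrow> 'a) \<Rightarrow> 'a set \<Rightarrow> 'a set" where
  "gen_diff_ideal R d S = \<Inter>{I. diff_ideal I R d \<and> S \<subseteq> I}"

text \<open>Differential transcendence degree over \<open>\<rat>\<close> of a finite set of Laurent differential
  polynomials with constant coefficients: the maximal number of differentially independent
  elements of the set.\<close>

definition diff_indep :: "('x der, rat) laurent set \<Rightarrow> bool" where
  "diff_indep T \<longleftrightarrow>
     (\<forall>p :: (('x der, rat) laurent der, rat) mpoly.
        mvars p \<subseteq> ders T \<and>
        meval mconst (\<lambda>v. case v of Der t k \<Rightarrow> (dl_deriv (\<lambda>_. 0) ^^ k) t) p = 0 \<longrightarrow> p = 0)"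

definition diff_trdeg :: "('x der, rat) laurent set \<Rightarrow> nat" where
  "diff_trdeg S = Max (card ` {T. T \<subseteq> S \<and> diff_indep T})"


subsection \<open>Rankings and differential remainders\<close>

text \<open>\<open>(v, w) \<in> r\<close> means that \<open>v\<close> is not higher than \<open>w\<close>.\<close>

definition ranking :: "'x set \<Rightarrow> ('x der \<times> 'x der) set \<Rightarrow> bool" where
  "ranking X r \<longleftrightarrow> linear_order_on (ders X) r \<and>
     (\<forall>v\<in>ders X. (v, shift v) \<in> r) \<and> (\<forall>v w. (v, w) \<in> r \<longrightarrow> (shift v, shift w) \<in> r)"

definition elim_ranking :: "'x set \<Rightarrow> ('x der \<times> 'x der) set \<Rightarrow> bool" where
  "elim_ranking X r \<longleftrightarrow> ranking X r \<and>
     (\<forall>x\<in>X. \<forall>y\<in>X. x \<noteq> y \<and> (Der x 0, Der y 0) \<in> r \<longrightarrow> (\<forall>k m. (Der x k, Der y m) \<in> r))"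

definition leader :: "('x der \<times> 'x der) set \<Rightarrow> ('x der, 'a::zero) mpoly \<Rightarrow> 'x der" where
  "leader r R = (THE v. v \<in> mvars R \<and> (\<forall>w\<in>mvars R. (w, v) \<in> r))"

text \<open>\<open>reducible_at r R k f\<close>: with \<open>v = \<partial>\<^sup>k \<theta>\<close>, \<open>\<theta>\<close> the leader of \<open>R\<close>, one can
  pseudo-divide \<open>f\<close> by \<open>\<partial>\<^sup>k R\<close> as polynomials in \<open>v\<close>. For \<open>k \<ge> 1\<close>, \<open>\<partial>\<^sup>k R\<close> has degree one in \<open>v\<close>, with
  leading coefficient the separant of \<open>R\<close>; for \<open>k = 0\<close> the leading coefficient is the initial.\<close>

definition reducible_at ::
  "('x der \<times> 'x der) set \<Rightarrow> ('x der, 'a::comm_ring_1) mpoly \<Rightarrow> nat \<Rightarrow> ('x der, 'a) mpoly \<Rightarrow> bool" where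
  "reducible_at r R k f \<longleftrightarrow>
     (let v = (shift ^^ k) (leader r R) in deg_in v ((dp_deriv ^^ k) R) \<le> deg_in v f)"

definition diff_reduced ::
  "('x der \<times> 'x der) set \<Rightarrow> ('x der, 'a::comm_ring_1) mpoly \<Rightarrow> ('x der, 'a) mpoly \<Rightarrow> bool" where
  "diff_reduced r R f \<longleftrightarrow> (\<forall>k. \<not> reducible_at r R k f)"

text \<open>One step of Ritt's reduction, at the highest derivative of the leader that can be reduced.\<close>

definition ritt_step ::
  "('x der \<times> 'x der) set \<Rightarrow> ('x der, 'a::comm_ring_1) mpoly \<Rightarrow>
     ('x der, 'a) mpoly \<Rightarrow> ('x der, 'a) mpoly \<Rightarrow> bool" where
  "ritt_step r R f f' \<longleftrightarrow>
     (\<exists>k. reducible_at r R k f \<and> (\<forall>k'>k. \<not> reducible_at r R k' f) \<and>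
        (let v = (shift ^^ k) (leader r R); g = (dp_deriv ^^ k) R in
           f' = lcoeff_in v g * f - lcoeff_in v f * mvar v ^ (deg_in v f - deg_in v g) * g))"

definition diff_remainder ::
  "('x der \<times> 'x der) set \<Rightarrow> ('x der, 'a::comm_ring_1) mpoly \<Rightarrow>
     ('x der, 'a) mpoly \<Rightarrow> ('x der, 'a) mpoly \<Rightarrow> bool" where
  "diff_remainder r R f f' \<longleftrightarrow> (ritt_step r R)\<^sup>*\<^sup>* f f' \<and> diff_reduced r R f'"


section \<open>The generic system\<close>

text \<open>The differential indeterminates: \<open>u\<^sub>j\<close> is \<open>j\<close>, \<open>\<aa>\<^sub>i\<close> is \<open>AI i 0\<close> and \<open>\<aa>\<^sub>i\<^sub>,\<^sub>k\<close> is \<open>AI i k\<close> for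
  \<open>1 \<le> k \<le> l i\<close>. Likewise \<open>M i 0\<close> is the (exponent of the) monomial \<open>M\<^sub>i\<close> and \<open>M i k\<close> is \<open>M\<^sub>i\<^sub>,\<^sub>k\<close>.\<close>

datatype aind = AI nat nat

type_synonym umonom = "nat der \<Rightarrow>\<^sub>0 int"
type_synonym dpoly = "(aind der, rat) mpoly"
type_synonym ldpoly = "(nat der, dpoly) laurent"

definition A_set :: "(nat \<Rightarrow> nat) \<Rightarrow> nat \<Rightarrow> aind set" where
  "A_set l i = {AI i k | k. k \<le> l i}"

definition A_all :: "nat \<Rightarrow> (nat \<Rightarrow> nat) \<Rightarrow> aind set" where
  "A_all n l = (\<Union>i\<in>{1..n}. A_set l i)"

definition D_ring :: "nat \<Rightarrow> (nat \<Rightarrow> nat) \<Rightarrow> dpoly ring" where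
  "D_ring n l = poly_ring (ders (A_all n l))"

definition DU_ring :: "nat \<Rightarrow> (nat \<Rightarrow> nat) \<Rightarrow> ldpoly ring" where
  "DU_ring n l = laurent_ring (carrier (D_ring n l)) (ders {1..n-1})"

abbreviation ld_deriv :: "ldpoly \<Rightarrow> ldpoly" where
  "ld_deriv \<equiv> dl_deriv dp_deriv"

definition FF :: "(nat \<Rightarrow> nat) \<Rightarrow> (nat \<Rightarrow> nat \<Rightarrow> umonom) \<Rightarrow> nat \<Rightarrow> ldpoly" where
  "FF l M i = (\<Sum>k\<le>l i. Poly_Mapping.single (M i k) (mvar (Der (AI i k) 0)))"

definition PP :: "nat \<Rightarrow> (nat \<Rightarrow> nat) \<Rightarrow> (nat \<Rightarrow> nat \<Rightarrow> umonom) \<Rightarrow> ldpoly set" where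
  "PP n l M = FF l M ` {1..n}"

definition generic_system :: "nat \<Rightarrow> (nat \<Rightarrow> nat) \<Rightarrow> (nat \<Rightarrow> nat \<Rightarrow> umonom) \<Rightarrow> bool" where
  "generic_system n l M \<longleftrightarrow>
     2 \<le> n \<and>
     (\<forall>i\<in>{1..n}. inj_on (M i) {..l i}) \<and>
     (\<forall>i\<in>{1..n}. \<forall>k\<le>l i. Poly_Mapping.keys (M i k) \<subseteq> ders {1..n-1}) \<and>
     (\<forall>i\<in>{1..n}. mvars (FF l M i) \<noteq> {}) \<and>
     (\<forall>j\<in>{1..n-1}. \<exists>i\<in>{1..n}. \<exists>k. Der j k \<in> mvars (FF l M i))"

definition diff_essential :: "nat \<Rightarrow> (nat \<Rightarrow> nat) \<Rightarrow> (nat \<Rightarrow> nat \<Rightarrow> umonom) \<Rightarrow> bool" where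
  "diff_essential n l M \<longleftrightarrow>
     (\<exists>k :: nat \<Rightarrow> nat. (\<forall>i\<in>{1..n}. k i \<in> {1..l i}) \<and>
        diff_trdeg ((\<lambda>i. Poly_Mapping.single (M i (k i) - M i 0) 1) ` {1..n}) = n - 1)"

definition zeta :: "(nat \<Rightarrow> nat) \<Rightarrow> (nat \<Rightarrow> nat \<Rightarrow> umonom) \<Rightarrow> nat \<Rightarrow> ldpoly" where
  "zeta l M i =
     - (\<Sum>k\<in>{1..l i}. Poly_Mapping.single (M i k - M i 0) (mvar (Der (AI i k) 0)))"

definition eval_zeta :: "(nat \<Rightarrow> nat) \<Rightarrow> (nat \<Rightarrow> nat \<Rightarrow> umonom) \<Rightarrow> dpoly \<Rightarrow> ldpoly" where
  "eval_zeta l M H = meval (\<lambda>c. mconst (mconst c))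
     (\<lambda>v. case v of Der a m \<Rightarrow> (case a of AI i k \<Rightarrow>
        if k = 0 then (ld_deriv ^^ m) (zeta l M i) else mconst (mvar v))) H"


subsection \<open>The sparse differential resultant\<close>

definition elim_ideal :: "nat \<Rightarrow> (nat \<Rightarrow> nat) \<Rightarrow> (nat \<Rightarrow> nat \<Rightarrow> umonom) \<Rightarrow> dpoly set" where
  "elim_ideal n l M = {f \<in> carrier (D_ring n l).
     mconst f \<in> gen_diff_ideal (DU_ring n l) ld_deriv (PP n l M)}"

definition sat_ideal :: "nat \<Rightarrow> (nat \<Rightarrow> nat) \<Rightarrow> dpoly \<Rightarrow> dpoly set" where
  "sat_ideal n l R = {f \<in> carrier (D_ring n l).
     \<forall>r. elim_ranking (A_all n l) r \<longrightarrow> diff_remainder r R f 0}"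

text \<open>\<open>R\<close> is determined up to a factor in \<open>\<rat> - {0}\<close>.\<close>

definition is_diff_res ::
  "nat \<Rightarrow> (nat \<Rightarrow> nat) \<Rightarrow> (nat \<Rightarrow> nat \<Rightarrow> umonom) \<Rightarrow> dpoly \<Rightarrow> bool" where
  "is_diff_res n l M R \<longleftrightarrow> R \<in> carrier (D_ring n l) \<and> ring_irreducible\<^bsub>D_ring n l\<^esub> R \<and>
     elim_ideal n l M = sat_ideal n l R"


subsection \<open>Orders\<close>

text \<open>Orders are extended reals; the supremum of the empty set is \<open>-\<infinity>\<close>.\<close>

definition occ_orders :: "nat \<Rightarrow> ldpoly \<Rightarrow> nat set" where
  "occ_orders j f = {k. Der j k \<in> mvars f}"

definition ord_u :: "(nat \<Rightarrow> nat) \<Rightarrow> (nat \<Rightarrow> nat \<Rightarrow> umonom) \<Rightarrow> nat \<Rightarrow> nat \<Rightarrow> ereal" where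
  "ord_u l M i j = (SUP k\<in>occ_orders j (FF l M i). ereal (real k))"

definition ord_A :: "(nat \<Rightarrow> nat) \<Rightarrow> dpoly \<Rightarrow> nat \<Rightarrow> ereal" where
  "ord_A l H i = (SUP k\<in>{k. \<exists>a\<in>A_set l i. Der a k \<in> mvars H}. ereal (real k))"

definition Jac :: "nat \<Rightarrow> (nat \<Rightarrow> nat) \<Rightarrow> (nat \<Rightarrow> nat \<Rightarrow> umonom) \<Rightarrow> nat \<Rightarrow> ereal" where
  "Jac n l M i = (SUP \<mu>\<in>{\<mu>. bij_betw \<mu> ({1..n} - {i}) {1..n-1}}.
     \<Sum>h\<in>{1..n} - {i}. ord_u l M h (\<mu> h))"

definition super_essential :: "nat \<Rightarrow> (nat \<Rightarrow> nat) \<Rightarrow> (nat \<Rightarrow> nat \<Rightarrow> umonom) \<Rightarrow> bool" where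
  "super_essential n l M \<longleftrightarrow> (\<forall>i\<in>{1..n}. 0 \<le> Jac n l M i)"

definition gam :: "nat \<Rightarrow> (nat \<Rightarrow> nat) \<Rightarrow> (nat \<Rightarrow> nat \<Rightarrow> umonom) \<Rightarrow> nat \<Rightarrow> nat" where
  "gam n l M j = Min (\<Union>i\<in>{1..n}. occ_orders j (FF l M i))"

definition gam_sum :: "nat \<Rightarrow> (nat \<Rightarrow> nat) \<Rightarrow> (nat \<Rightarrow> nat \<Rightarrow> umonom) \<Rightarrow> nat" where
  "gam_sum n l M = (\<Sum>j\<in>{1..n-1}. gam n l M j)"

definition M_max :: "nat \<Rightarrow> (nat \<Rightarrow> nat) \<Rightarrow> (nat \<Rightarrow> nat \<Rightarrow> umonom) \<Rightarrow> nat \<Rightarrow> ereal" where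
  "M_max n l M j = (SUP i\<in>{1..n}. ord_u l M i j + Jac n l M i) - ereal (real (gam_sum n l M))"

definition ps :: "nat \<Rightarrow> (nat \<Rightarrow> nat) \<Rightarrow> (nat \<Rightarrow> nat \<Rightarrow> umonom) \<Rightarrow> ldpoly set" where
  "ps n l M = {(ld_deriv ^^ k) (FF l M i) | i k.
     i \<in> {1..n} \<and> ereal (real k) \<le> Jac n l M i - ereal (real (gam_sum n l M))}"

definition Lnum :: "nat \<Rightarrow> (nat \<Rightarrow> nat) \<Rightarrow> (nat \<Rightarrow> nat \<Rightarrow> umonom) \<Rightarrow> nat" where
  "Lnum n l M = card (ps n l M)"

definition VV :: "nat \<Rightarrow> (nat \<Rightarrow> nat) \<Rightarrow> (nat \<Rightarrow> nat \<Rightarrow> umonom) \<Rightarrow> nat der set" where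
  "VV n l M = {Der j k | j k. j \<in> {1..n-1} \<and> gam n l M j \<le> k \<and> ereal (real k) \<le> M_max n l M j}"


subsection \<open>The ideals \<open>\<I>(H)\<close>\<close>

definition PS :: "nat \<Rightarrow> (nat \<Rightarrow> nat) \<Rightarrow> (nat \<Rightarrow> nat \<Rightarrow> umonom) \<Rightarrow> (nat \<Rightarrow> ereal) \<Rightarrow> ldpoly set" where
  "PS n l M \<tau> = {(ld_deriv ^^ k) (FF l M i) | i k. i \<in> {1..n} \<and> ereal (real k) \<le> \<tau> i}"

definition V_tau ::
  "nat \<Rightarrow> (nat \<Rightarrow> nat) \<Rightarrow> (nat \<Rightarrow> nat \<Rightarrow> umonom) \<Rightarrow> (nat \<Rightarrow> ereal) \<Rightarrow> nat der set" where
  "V_tau n l M \<tau> = {Der j k | j k. j \<in> {1..n-1} \<and> gam n l M j \<le> k \<and>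
     ereal (real k) \<le> (SUP i\<in>{1..n}. ord_u l M i j + \<tau> i)}"

definition A_tau :: "nat \<Rightarrow> (nat \<Rightarrow> nat) \<Rightarrow> (nat \<Rightarrow> ereal) \<Rightarrow> aind der set" where
  "A_tau n l \<tau> = {Der a k | a k. \<exists>i\<in>{1..n}. a \<in> A_set l i \<and> ereal (real k) \<le> \<tau> i}"

definition QA_ring :: "nat \<Rightarrow> (nat \<Rightarrow> nat) \<Rightarrow> (nat \<Rightarrow> ereal) \<Rightarrow> dpoly ring" where
  "QA_ring n l \<tau> = poly_ring (A_tau n l \<tau>)"

definition I_ideal ::
  "nat \<Rightarrow> (nat \<Rightarrow> nat) \<Rightarrow> (nat \<Rightarrow> nat \<Rightarrow> umonom) \<Rightarrow> dpoly \<Rightarrow> dpoly set" where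
  "I_ideal n l M H =
     (let \<sigma> = ord_A l H; B = carrier (QA_ring n l \<sigma>) in
       {f \<in> B. mconst f \<in> Idl\<^bsub>laurent_ring B (V_tau n l M \<sigma>)\<^esub> (PS n l M \<sigma>)})"


section \<open>The algebraic generic system\<close>

text \<open>The algebraic indeterminates \<open>y\<^sub>h\<close> are indexed by a finite type \<open>'y\<close>, which has as many
  elements as \<open>VV n l M\<close> when \<open>\<upsilon> :: 'y \<Rightarrow> nat der\<close> is a bijection onto \<open>VV n l M\<close>. Exponents
  \<open>\<alpha> \<in> \<int>\<^bsup>L-1\<^esup>\<close> are elements of \<open>int ^ 'y\<close>, and \<open>c\<^sup>h\<^sub>\<alpha>\<close> is the pair \<open>(h, \<alpha>)\<close>.\<close>

type_synonym 'y cpoly = "(nat \<times> (int ^ 'y), rat) mpoly"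

definition umon :: "('y::finite \<Rightarrow> nat der) \<Rightarrow> int ^ 'y \<Rightarrow> umonom" where
  "umon \<upsilon> \<alpha> = (\<Sum>h\<in>UNIV. Poly_Mapping.single (\<upsilon> h) (\<alpha> $ h))"

definition supp_y :: "('y::finite \<Rightarrow> nat der) \<Rightarrow> ldpoly \<Rightarrow> (int ^ 'y) set" where
  "supp_y \<upsilon> f = {\<alpha>. Poly_Mapping.lookup f (umon \<upsilon> \<alpha>) \<noteq> 0}"

definition C_set :: "nat \<Rightarrow> (nat \<Rightarrow> (int ^ 'y) set) \<Rightarrow> (nat \<times> (int ^ 'y)) set" where
  "C_set L A = {(h, \<alpha>). h \<in> {1..L} \<and> \<alpha> \<in> A h}"

definition P_ags :: "(nat \<Rightarrow> (int ^ 'y::finite) set) \<Rightarrow> nat \<Rightarrow> (int ^ 'y) \<Rightarrow>\<^sub>0 'y cpoly" where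
  "P_ags A h = (\<Sum>\<alpha>\<in>A h. Poly_Mapping.single \<alpha> (mvar (h, \<alpha>)))"

definition Xi :: "(nat \<Rightarrow> ldpoly) \<Rightarrow> ('y::finite \<Rightarrow> nat der) \<Rightarrow> nat \<times> (int ^ 'y) \<Rightarrow> dpoly" where
  "Xi \<rho> \<upsilon> = (\<lambda>(h, \<alpha>). Poly_Mapping.lookup (\<rho> h) (umon \<upsilon> \<alpha>))"

text \<open>The standing assumption that the coefficient corresponding to \<open>M\<^sub>i\<close> in \<open>\<partial>\<^sup>k F\<^sub>i\<close> specializes to
  \<open>\<partial>\<^sup>k \<aa>\<^sub>i\<close>.\<close>

definition distinguished_coeffs ::
  "nat \<Rightarrow> (nat \<Rightarrow> nat) \<Rightarrow> (nat \<Rightarrow> nat \<Rightarrow> umonom) \<Rightarrow> (nat \<Rightarrow> ldpoly) \<Rightarrow>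
     ('y::finite \<Rightarrow> nat der) \<Rightarrow> bool" where
  "distinguished_coeffs n l M \<rho> \<upsilon> \<longleftrightarrow>
     (\<forall>h\<in>{1..Lnum n l M}. \<forall>i\<in>{1..n}. \<forall>k. \<rho> h = (ld_deriv ^^ k) (FF l M i) \<longrightarrow>
        (\<exists>\<alpha>\<in>supp_y \<upsilon> (\<rho> h). umon \<upsilon> \<alpha> = M i 0 \<and> Xi \<rho> \<upsilon> (h, \<alpha>) = mvar (Der (AI i 0) k)))"


subsection \<open>The Canny--Emiris construction\<close>

text \<open>In this subsection \<open>A h\<close> is the support of the \<open>h\<close>-th polynomial, \<open>1 \<le> h \<le> L\<close>, and the linear
  lifting of its Newton polytope is \<open>x \<mapsto> \<omega> h \<bullet> x\<close>. Sums of sets are Minkowski sums.\<close>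

definition rvec :: "int ^ 'y \<Rightarrow> real ^ 'y" where
  "rvec \<alpha> = (\<chi> h. real_of_int (\<alpha> $ h))"

definition newton :: "(nat \<Rightarrow> (int ^ 'y::finite) set) \<Rightarrow> nat \<Rightarrow> (real ^ 'y) set" where
  "newton A h = convex hull (rvec ` A h)"

definition mink :: "nat \<Rightarrow> (nat \<Rightarrow> (int ^ 'y::finite) set) \<Rightarrow> (real ^ 'y) set" where
  "mink L A = (\<Sum>h\<in>{1..L}. newton A h)"

definition lift :: "real ^ 'y::finite \<Rightarrow> (real ^ 'y) set \<Rightarrow> ((real ^ 'y) \<times> real) set" where
  "lift w S = (\<lambda>x. (x, w \<bullet> x)) ` S"

definition lower_envelope :: "('a \<times> real) set \<Rightarrow> ('a \<times> real) set" where
  "lower_envelope T = {(x, t) \<in> T. \<forall>s. (x, s) \<in> T \<longrightarrow> t \<le> s}"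

text \<open>A maximal cell, given by its summands \<open>F h\<close>, is the projection of a face of the
  lifted Minkowski sum lying on the lower envelope; a face of a Minkowski sum of polytopes decomposes
  uniquely into faces of the summands.\<close>

definition max_cells ::
  "nat \<Rightarrow> (nat \<Rightarrow> (int ^ 'y::finite) set) \<Rightarrow> (nat \<Rightarrow> real ^ 'y) \<Rightarrow> (nat \<Rightarrow> (real ^ 'y) set) set" where
  "max_cells L A \<omega> = {F \<in> (\<Pi>\<^sub>E h\<in>{1..L}. {G. G face_of newton A h}).
     (\<Sum>h\<in>{1..L}. lift (\<omega> h) (F h)) face_of (\<Sum>h\<in>{1..L}. lift (\<omega> h) (newton A h)) \<and>
     (\<Sum>h\<in>{1..L}. lift (\<omega> h) (F h))
        \<subseteq> lower_envelope (\<Sum>h\<in>{1..L}. lift (\<omega> h) (newton A h)) \<and>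
     aff_dim (\<Sum>h\<in>{1..L}. F h) = aff_dim (mink L A)}"

text \<open>The lifting is sufficiently generic if it induces a mixed subdivision.\<close>

definition generic_lifting ::
  "nat \<Rightarrow> (nat \<Rightarrow> (int ^ 'y::finite) set) \<Rightarrow> (nat \<Rightarrow> real ^ 'y) \<Rightarrow> bool" where
  "generic_lifting L A \<omega> \<longleftrightarrow>
     (\<forall>F\<in>max_cells L A \<omega>. (\<Sum>h\<in>{1..L}. aff_dim (F h)) = aff_dim (mink L A))"

definition aff_lattice :: "(int ^ 'y) set \<Rightarrow> (int ^ 'y) set" where
  "aff_lattice S = {\<Sum>x\<in>T. c x *s x | T c. finite T \<and> T \<subseteq> S \<and> (\<Sum>x\<in>T. c x) = (1::int)}"

definition EE :: "nat \<Rightarrow> (nat \<Rightarrow> (int ^ 'y::finite) set) \<Rightarrow> real ^ 'y \<Rightarrow> (int ^ 'y) set" where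
  "EE L A \<delta> = {p \<in> aff_lattice (\<Sum>h\<in>{1..L}. A h). rvec p - \<delta> \<in> mink L A}"

definition generic_shift ::
  "nat \<Rightarrow> (nat \<Rightarrow> (int ^ 'y::finite) set) \<Rightarrow> (nat \<Rightarrow> real ^ 'y) \<Rightarrow> real ^ 'y \<Rightarrow> bool" where
  "generic_shift L A \<omega> \<delta> \<longleftrightarrow>
     \<delta> \<in> {x - y | x y. x \<in> affine hull (mink L A) \<and> y \<in> affine hull (mink L A)} \<and>
     EE L A \<delta> \<noteq> {} \<and>
     (\<forall>p\<in>EE L A \<delta>. \<exists>F\<in>max_cells L A \<omega>. rvec p - \<delta> \<in> rel_interior (\<Sum>h\<in>{1..L}. F h))"

definition cell_of ::
  "nat \<Rightarrow> (nat \<Rightarrow> (int ^ 'y::finite) set) \<Rightarrow> (nat \<Rightarrow> real ^ 'y) \<Rightarrow> real ^ 'y \<Rightarrow> int ^ 'y \<Rightarrow>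
     nat \<Rightarrow> (real ^ 'y) set" where
  "cell_of L A \<omega> \<delta> p =
     (THE F. F \<in> max_cells L A \<omega> \<and> rvec p - \<delta> \<in> rel_interior (\<Sum>h\<in>{1..L}. F h))"

text \<open>The index order \<open>ro\<close> is a linear order on \<open>{1..L}\<close>, \<open>(g, h) \<in> ro\<close> meaning \<open>g \<le> h\<close>.\<close>

definition index_of ::
  "nat \<Rightarrow> (nat \<times> nat) set \<Rightarrow> (nat \<Rightarrow> (real ^ 'y::finite) set) \<Rightarrow> nat" where
  "index_of L ro F = (THE h. h \<in> {1..L} \<and> (\<exists>x. F h = {x}) \<and>
     (\<forall>g\<in>{1..L}. (\<exists>x. F g = {x}) \<longrightarrow> (g, h) \<in> ro))"

definition sylv_entry ::
  "nat \<Rightarrow> (nat \<Rightarrow> (int ^ 'y::finite) set) \<Rightarrow> (nat \<Rightarrow> real ^ 'y) \<Rightarrow> real ^ 'y \<Rightarrow> (nat \<times> nat) set \<Rightarrow>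
     int ^ 'y \<Rightarrow> int ^ 'y \<Rightarrow> 'y cpoly" where
  "sylv_entry L A \<omega> \<delta> ro p q =
     (let F = cell_of L A \<omega> \<delta> p; h = index_of L ro F; a = (THE a. F h = {rvec a}) in
       Poly_Mapping.lookup (Poly_Mapping.single (p - a) 1 * P_ags A h) q)"

definition det_on :: "'i set \<Rightarrow> ('i \<Rightarrow> 'i \<Rightarrow> 'a::comm_ring_1) \<Rightarrow> 'a" where
  "det_on E S = (\<Sum>\<pi>\<in>{\<pi>. \<pi> permutes E}. of_int (sign \<pi>) * (\<Prod>p\<in>E. S p (\<pi> p)))"

definition sylv_det ::
  "nat \<Rightarrow> (nat \<Rightarrow> (int ^ 'y::finite) set) \<Rightarrow> (nat \<Rightarrow> real ^ 'y) \<Rightarrow> real ^ 'y \<Rightarrow> (nat \<times> nat) set \<Rightarrow>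
     'y cpoly" where
  "sylv_det L A \<omega> \<delta> ro = det_on (EE L A \<delta>) (sylv_entry L A \<omega> \<delta> ro)"


section \<open>The specialization algorithm\<close>

definition subst_var ::
  "'c \<Rightarrow> 'a::comm_ring_1 \<Rightarrow> ('c, 'a) mpoly \<Rightarrow> ('c, 'a) mpoly" where
  "subst_var c d H = meval mconst (\<lambda>v. if v = c then mconst d else mvar v) H"

text \<open>The reachable pairs \<open>(\<Delta>, H)\<close>; \<open>H\<close> is a polynomial in the remaining \<open>c\<close> with coefficients in
  the differential polynomials, so the input is coerced coefficientwise.\<close>

inductive spec_reach ::
  "'c set \<Rightarrow> ('c \<Rightarrow> dpoly) \<Rightarrow> ('c, rat) mpoly \<Rightarrow> 'c set \<Rightarrow> ('c, dpoly) mpoly \<Rightarrow> bool"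
  for C \<xi> Q where
  start: "spec_reach C \<xi> Q {} (Poly_Mapping.map mconst Q)"
| substitute: "spec_reach C \<xi> Q \<Delta> H \<Longrightarrow> c \<in> C - \<Delta> \<Longrightarrow> subst_var c (\<xi> c) H \<noteq> 0 \<Longrightarrow>
    spec_reach C \<xi> Q (insert c \<Delta>) (subst_var c (\<xi> c) H)"
| divide: "spec_reach C \<xi> Q \<Delta> H \<Longrightarrow> c \<in> C - \<Delta> \<Longrightarrow> subst_var c (\<xi> c) H = 0 \<Longrightarrow>
    1 \<le> s \<Longrightarrow> H = (mvar c - mconst (\<xi> c)) ^ s * H' \<Longrightarrow> subst_var c (\<xi> c) H' \<noteq> 0 \<Longrightarrow>
    spec_reach C \<xi> Q (insert c \<Delta>) (subst_var c (\<xi> c) H')"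

definition spec_output ::
  "'c set \<Rightarrow> ('c \<Rightarrow> dpoly) \<Rightarrow> ('c, rat) mpoly \<Rightarrow> dpoly \<Rightarrow> bool" where
  "spec_output C \<xi> Q H\<^sub>0 \<longleftrightarrow> spec_reach C \<xi> Q C (mconst H\<^sub>0)"

text \<open>The set \<open>\<H>\<close> of irreducible factors \<open>H\<close> of \<open>H\<^sub>0\<close> with \<open>H(\<zeta>) = 0\<close>.\<close>

definition zeta_factors ::
  "nat \<Rightarrow> (nat \<Rightarrow> nat) \<Rightarrow> (nat \<Rightarrow> nat \<Rightarrow> umonom) \<Rightarrow> dpoly \<Rightarrow> dpoly set" where
  "zeta_factors n l M H\<^sub>0 = {H \<in> carrier (D_ring n l). ring_irreducible\<^bsub>D_ring n l\<^esub> H \<and>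
     H divides\<^bsub>D_ring n l\<^esub> H\<^sub>0 \<and> eval_zeta l M H = 0}"

end

theory Submission
  imports Defs "HOL-Computational_Algebra.Polynomial"
begin

text \<open>Let \<open>H\<close> be the given factor and \<open>\<sigma>\<close> its vector of orders. Modulo \<open>\<partial>\<^sup>m (M\<^sub>i\<^sup>-\<^sup>1 F\<^sub>i)\<close>, which lies in the
  ideal of \<open>F\<^sub>i, \<dots>, \<partial>\<^sup>m F\<^sub>i\<close>, the variable \<open>\<partial>\<^sup>m \<aa>\<^sub>i\<close> is congruent to \<open>\<partial>\<^sup>m \<zeta>\<^sub>i\<close>; hence a differential polynomial vanishing
  at \<open>\<zeta>\<close> lies in the elimination ideal, and, if its orders are at most \<open>\<sigma>\<close>, in \<open>\<I>(H)\<close>. Conversely, elements of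
  the elimination ideal vanish at \<open>\<zeta>\<close>. So \<open>H\<close> reduces to \<open>0\<close> modulo \<open>R\<close> under every elimination ranking, which
  forces the orders of \<open>R\<close> to be at most \<open>\<sigma>\<close>, and \<open>R\<close> lies in \<open>\<I>(H)\<close> as well. A prime of height one
  over \<open>\<I>(H)\<close> contains the principal ideal of \<open>H\<close>, which is itself prime because polynomial
  rings over a field are factorial; so \<open>H\<close> divides \<open>R\<close>, and both are associated.\<close>

section \<open>Ring homomorphisms and variables\<close>

text \<open>The rule \<open>update_induct\<close> adds a term at a fresh exponent. Trading freshness
  for closure under addition reduces every identity that is additive in \<open>p\<close> to single
  terms.\<close>

lemma poly_mapping_additive_induct [case_names zero single add]:
  fixes p :: "'e \<Rightarrow>\<^sub>0 'a::comm_monoid_add"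
  assumes "P 0" "\<And>m c. P (Poly_Mapping.single m c)" "\<And>p q. P p \<Longrightarrow> P q \<Longrightarrow> P (p + q)"
  shows "P p"
proof (induction p rule: update_induct)
  case const
  then show ?case by (rule assms)
next
  case (update f a b)
  have "Poly_Mapping.update a b f = Poly_Mapping.single a b + f"
    using update(1) by (intro poly_mapping_eqI) (auto simp: lookup_update lookup_add lookup_single in_keys_iff)
  then show ?case using assms update by simp
qed

definition ring_hom_fun :: "('a::comm_ring_1 \<Rightarrow> 'b::comm_ring_1) \<Rightarrow> bool" where
  "ring_hom_fun h \<longleftrightarrow> h 1 = 1 \<and> (\<forall>a b. h (a + b) = h a + h b) \<and> (\<forall>a b. h (a * b) = h a * h b)"

lemma ring_hom_funD:
  assumes "ring_hom_fun h"
  shows "h 0 = 0" "h 1 = 1" "h (a + b) = h a + h b" "h (a * b) = h a * h b"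
    "h (- a) = - h a" "h (a - b) = h a - h b" "h (a ^ k) = h a ^ k" "h (prod g S) = prod (\<lambda>x. h (g x)) S"
    "h (sum g S) = sum (\<lambda>x. h (g x)) S" "h (of_nat k) = of_nat k"
proof -
  have add: "\<And>a b. h (a + b) = h a + h b" and mult: "\<And>a b. h (a * b) = h a * h b" and one: "h 1 = 1"
    using assms by (auto simp: ring_hom_fun_def)
  show z: "h 0 = 0" using add[of 0 0] by simp
  show u: "h (- a) = - h a" for a using add[of a "- a"] z by (simp add: eq_neg_iff_add_eq_0 add.commute)
  show "h (a - b) = h a - h b" using add[of a "- b"] u by simp
  show "h (a ^ k) = h a ^ k" by (induction k) (auto simp: mult one)
  show "h (prod g S) = prod (\<lambda>x. h (g x)) S"
    by (induction S rule: infinite_finite_induct) (auto simp: mult one)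
  show "h (sum g S) = sum (\<lambda>x. h (g x)) S"
    by (induction S rule: infinite_finite_induct) (auto simp: add z)
  show "h (of_nat k) = of_nat k" by (induction k) (auto simp: add one z)
qed (use assms in \<open>auto simp: ring_hom_fun_def\<close>)

lemma ring_hom_fun_comp: "ring_hom_fun g \<Longrightarrow> ring_hom_fun h \<Longrightarrow> ring_hom_fun (\<lambda>x. g (h x))"
  by (auto simp: ring_hom_fun_def)

lemma mconst_0 [simp]: "mconst 0 = 0" and mconst_1 [simp]: "mconst 1 = 1"
  by (auto simp: mconst_def)

lemma mconst_add: "mconst (a + b) = mconst a + mconst b"
  by (auto simp: mconst_def single_add)

lemma mconst_mult:
  "mconst (a * b) = (mconst a * mconst b :: 'e::comm_monoid_add \<Rightarrow>\<^sub>0 'a::comm_ring_1)"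
  by (auto simp: mconst_def mult_single)

lemma ring_hom_mconst: "ring_hom_fun (mconst :: 'a::comm_ring_1 \<Rightarrow> ('e::comm_monoid_add \<Rightarrow>\<^sub>0 'a))"
  by (auto simp: ring_hom_fun_def mconst_add mconst_mult)

lemma mconst_eq_0_iff [simp]: "mconst c = 0 \<longleftrightarrow> c = 0"
  unfolding mconst_def by (metis lookup_single_eq lookup_zero single_zero)

lemma mconst_mult_single:
  "mconst a * Poly_Mapping.single (m::'e::comm_monoid_add) b = Poly_Mapping.single m (a * b :: 'a::comm_ring_1)"
  by (simp add: mconst_def mult_single)

section \<open>Evaluation of polynomials as a ring homomorphism\<close>

lemma monom_value_add:
  fixes f :: "'v \<Rightarrow> 'r::comm_ring_1" and m m' :: "'v \<Rightarrow>\<^sub>0 nat"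
  shows "(\<Prod>v\<in>Poly_Mapping.keys (m + m'). f v ^ Poly_Mapping.lookup (m + m') v) =
    (\<Prod>v\<in>Poly_Mapping.keys m. f v ^ Poly_Mapping.lookup m v) *
    (\<Prod>v\<in>Poly_Mapping.keys m'. f v ^ Poly_Mapping.lookup m' v)"
proof -
  let ?S = "Poly_Mapping.keys m \<union> Poly_Mapping.keys m'"
  have *: "(\<Prod>v\<in>Poly_Mapping.keys k. f v ^ Poly_Mapping.lookup k v) = (\<Prod>v\<in>?S. f v ^ Poly_Mapping.lookup k v)"
    if "Poly_Mapping.keys k \<subseteq> ?S" for k :: "'v \<Rightarrow>\<^sub>0 nat"
    using that by (intro prod.mono_neutral_left) (auto simp: in_keys_iff)
  show ?thesis
    using *[of "m + m'"] *[of m] *[of m'] keys_add[of m m']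
    by (simp add: lookup_add power_add prod.distrib)
qed

lemma meval_single [simp]:
  "\<phi> 0 = 0 \<Longrightarrow> meval \<phi> f (Poly_Mapping.single m c) =
     \<phi> c * (\<Prod>v\<in>Poly_Mapping.keys m. f v ^ Poly_Mapping.lookup m v)"
  by (cases "c = 0") (auto simp: meval_def)

lemma meval_0 [simp]: "meval \<phi> f 0 = 0"
  by (simp add: meval_def)

lemma meval_add:
  assumes "ring_hom_fun \<phi>"
  shows "meval \<phi> f (p + q) = meval \<phi> f p + meval \<phi> f q"
  unfolding meval_def
  by (rule setsum_keys_plus_distrib) (auto simp: ring_hom_funD[OF assms] algebra_simps)

lemma meval_mult:
  assumes "ring_hom_fun \<phi>"
  shows "meval \<phi> f (p * q) = meval \<phi> f p * meval \<phi> f q"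
proof (induction p rule: poly_mapping_additive_induct)
  case (single m c)
  show ?case
  proof (induction q rule: poly_mapping_additive_induct)
    case (single m' c')
    show ?case
      using ring_hom_funD[OF assms] by (simp add: mult_single monom_value_add algebra_simps)
  qed (auto simp: meval_add[OF assms] algebra_simps)
qed (auto simp: meval_add[OF assms] algebra_simps)

lemma meval_mconst: "\<phi> 0 = 0 \<Longrightarrow> meval \<phi> f (mconst c) = \<phi> c"
  by (simp add: mconst_def)

lemma meval_mvar:
  "\<phi> 0 = 0 \<Longrightarrow> \<phi> 1 = 1 \<Longrightarrow> meval \<phi> f (mvar v) = f v"
  by (simp add: mvar_def)

lemma ring_hom_meval:
  assumes "ring_hom_fun \<phi>"
  shows "ring_hom_fun (meval \<phi> f)"
  unfolding ring_hom_fun_def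
  using meval_add[OF assms] meval_mult[OF assms] meval_mconst[of \<phi> f 1] ring_hom_funD[OF assms]
  by auto

lemma monom_eq_prod_mvar:
  "Poly_Mapping.single m 1 = (\<Prod>v\<in>Poly_Mapping.keys m. (mvar v :: ('v, 'a::comm_ring_1) mpoly) ^ Poly_Mapping.lookup m v)"
proof (induction m rule: poly_mapping_additive_induct)
  case (single v k)
  have "Poly_Mapping.single (Poly_Mapping.single v k) 1 = (mvar v :: ('v, 'a) mpoly) ^ k"
  proof (induction k)
    case (Suc k)
    have "Poly_Mapping.single (Poly_Mapping.single v (Suc k)) (1::'a) =
        Poly_Mapping.single (Poly_Mapping.single v 1) 1 * Poly_Mapping.single (Poly_Mapping.single v k) 1"
      by (simp add: mult_single single_add[symmetric])
    then show ?case using Suc by (simp add: mvar_def)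
  qed simp
  then show ?case by simp
next
  case (add p q)
  then show ?case by (simp add: monom_value_add) (metis mult_1 mult_single)
qed simp

lemma mpoly_expand:
  "p = (\<Sum>m\<in>Poly_Mapping.keys p. mconst (Poly_Mapping.lookup p m) *
      (\<Prod>v\<in>Poly_Mapping.keys m. (mvar v :: ('v, 'a::comm_ring_1) mpoly) ^ Poly_Mapping.lookup m v))"
proof -
  have "p = (\<Sum>m\<in>Poly_Mapping.keys p. Poly_Mapping.single m (Poly_Mapping.lookup p m))"
    by (intro poly_mapping_eqI)
      (auto simp: lookup_sum lookup_single when_def in_keys_iff)
  then show ?thesis
    by (simp add: monom_eq_prod_mvar[symmetric] mconst_mult_single)
qed

text \<open>By \<open>mpoly_expand\<close>, \<open>p\<close> is built from constants and variables
  by ring operations. Agreement is required only at variables that occur in \<open>p\<close>, which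
  is what \<open>uni_const\<close> exploits.\<close>

lemma ring_hom_eqI:
  fixes p :: "('v, 'a::comm_ring_1) mpoly"
  assumes "ring_hom_fun g" "ring_hom_fun h" "\<And>c. g (mconst c) = h (mconst c)"
    and "\<And>v. v \<in> mvars p \<Longrightarrow> g (mvar v) = h (mvar v)"
  shows "g p = h p"
proof -
  have "(\<Prod>v\<in>Poly_Mapping.keys m. g (mvar v) ^ Poly_Mapping.lookup m v) =
      (\<Prod>v\<in>Poly_Mapping.keys m. h (mvar v) ^ Poly_Mapping.lookup m v)"
    if "m \<in> Poly_Mapping.keys p" for m
    by (intro prod.cong refl arg_cong2[where f = power] assms(4)) (use that in \<open>auto simp: mvars_def\<close>)
  then show ?thesis
    by (subst (1 2) mpoly_expand[of p])
      (auto simp: ring_hom_funD[OF assms(1)] ring_hom_funD[OF assms(2)] assms(3))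
qed

lemma meval_id: "meval mconst mvar p = p"
  unfolding meval_def by (rule mpoly_expand[symmetric])

lemma sum_closed:
  assumes "0 \<in> S" "\<And>a b. a \<in> S \<Longrightarrow> b \<in> S \<Longrightarrow> a + b \<in> S" "\<And>x. x \<in> X \<Longrightarrow> g x \<in> S"
  shows "sum g X \<in> S"
  using assms(3) by (induction X rule: infinite_finite_induct) (auto intro: assms(1,2))

lemma prod_closed:
  assumes "1 \<in> S" "\<And>a b. a \<in> S \<Longrightarrow> b \<in> S \<Longrightarrow> a * b \<in> S" "\<And>x. x \<in> X \<Longrightarrow> g x \<in> S"
  shows "prod g X \<in> S"
  using assms(3) by (induction X rule: infinite_finite_induct) (auto intro: assms(1,2))

lemma power_closed:
  assumes "1 \<in> S" "\<And>a b. a \<in> S \<Longrightarrow> b \<in> S \<Longrightarrow> a * b \<in> S" "x \<in> S"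
  shows "x ^ k \<in> S"
  using assms(3) by (induction k) (auto intro: assms(1,2))

text \<open>For \<open>\<phi> = mconst\<close> and \<open>f = mvar\<close> the value is
  \<open>p\<close> itself by \<open>meval_id\<close>, so this also serves as an induction principle
  for polynomials, with \<open>S\<close> as the induction predicate.\<close>

lemma meval_closed:
  assumes "0 \<in> S" "1 \<in> S" "\<And>a b. a \<in> S \<Longrightarrow> b \<in> S \<Longrightarrow> a + b \<in> S" "\<And>a b. a \<in> S \<Longrightarrow> b \<in> S \<Longrightarrow> a * b \<in> S"
    and "\<And>c. \<phi> c \<in> S" "\<And>v. v \<in> mvars p \<Longrightarrow> f v \<in> S"
  shows "meval \<phi> f p \<in> S"
  unfolding meval_def
  by (intro sum_closed assms(1,3,4) prod_closed power_closed assms(2,5,6))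
    (auto simp: assms mvars_def)

section \<open>Variables of sums and products\<close>

lemma mvars_0 [simp]: "mvars 0 = {}"
  by (simp add: mvars_def)

lemma mvars_1 [simp]: "mvars (1 :: ('v \<Rightarrow>\<^sub>0 'e::comm_monoid_add) \<Rightarrow>\<^sub>0 'a::comm_ring_1) = {}"
  by (simp add: mvars_def)

lemma mvars_mconst [simp]: "mvars (mconst c) = {}"
  by (simp add: mvars_def mconst_def)

lemma mvars_mvar [simp]: "mvars (mvar v :: ('v, 'a::comm_ring_1) mpoly) = {v}"
  by (simp add: mvars_def mvar_def)

lemma finite_mvars [simp]: "finite (mvars p)"
  by (simp add: mvars_def)

lemma mvars_add: "mvars (p + q) \<subseteq> mvars p \<union> mvars (q :: ('v \<Rightarrow>\<^sub>0 'e::zero) \<Rightarrow>\<^sub>0 'a::monoid_add)"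
  using keys_add[of p q] by (auto simp: mvars_def)

lemma mvars_uminus [simp]: "mvars (- p) = mvars (p :: ('v \<Rightarrow>\<^sub>0 'e::zero) \<Rightarrow>\<^sub>0 'a::ab_group_add)"
  by (simp add: mvars_def in_keys_iff)

lemma mvars_diff: "mvars (p - q) \<subseteq> mvars p \<union> mvars (q :: ('v \<Rightarrow>\<^sub>0 'e::zero) \<Rightarrow>\<^sub>0 'a::ab_group_add)"
  using mvars_add[of p "- q"] by simp

lemma mvars_mult:
  "mvars (p * q) \<subseteq> mvars p \<union> mvars (q :: ('v \<Rightarrow>\<^sub>0 'e::comm_monoid_add) \<Rightarrow>\<^sub>0 'a::comm_ring_1)"
proof
  fix v assume "v \<in> mvars (p * q)"
  then obtain m where m: "m \<in> Poly_Mapping.keys (p * q)" "v \<in> Poly_Mapping.keys m"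
    by (auto simp: mvars_def)
  then obtain a b where ab: "m = a + b" "a \<in> Poly_Mapping.keys p" "b \<in> Poly_Mapping.keys q"
    using keys_mult[of p q] by auto
  then have "v \<in> Poly_Mapping.keys a \<union> Poly_Mapping.keys b"
    using m keys_add[of a b] by auto
  then show "v \<in> mvars p \<union> mvars q" using ab by (auto simp: mvars_def)
qed

lemma mvars_empty_iff:
  fixes p :: "('v, 'a::zero) mpoly"
  shows "mvars p = {} \<longleftrightarrow> (\<exists>c. p = mconst c)"
proof
  assume *: "mvars p = {}"
  have "p = mconst (Poly_Mapping.lookup p 0)"
    unfolding mconst_def using *
    by (intro poly_mapping_eqI) (force simp: lookup_single when_def mvars_def in_keys_iff)
  then show "\<exists>c. p = mconst c" ..
qed auto

section \<open>Factoriality of polynomial rings over a field\<close>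

text \<open>This is \<open>p\<close> read as a polynomial in the single variable \<open>x\<close>.
  The coefficients keep the full multivariate type; that \<open>x\<close> is absent from them is
  \<open>mvars_coeff_uni\<close>.\<close>

definition uni :: "'v \<Rightarrow> ('v, 'a::comm_ring_1) mpoly \<Rightarrow> ('v, 'a) mpoly poly" where
  "uni x = meval (\<lambda>c. [:mconst c:]) (\<lambda>v. if v = x then [:0, 1:] else [:mvar v:])"

lemma ring_hom_pCons: "ring_hom_fun (\<lambda>c. [:c:])"
  by (auto simp: ring_hom_fun_def one_pCons)

lemma ring_hom_uni: "ring_hom_fun (uni x)"
  unfolding uni_def
  by (intro ring_hom_meval ring_hom_fun_comp[OF ring_hom_pCons] ring_hom_mconst)

lemmas uni_simps = ring_hom_funD[OF ring_hom_uni]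

lemma uni_mconst: "uni x (mconst c) = [:mconst c:]"
  unfolding uni_def by (rule meval_mconst) simp

lemma uni_mvar: "uni x (mvar v) = (if v = x then [:0, 1:] else [:mvar v:])"
  unfolding uni_def by (rule meval_mvar) (auto simp: one_pCons)

lemma poly_uni: "poly (uni x p) (mvar x) = p"
proof -
  have "ring_hom_fun (\<lambda>p. poly p (mvar x :: ('a, 'b) mpoly))"
    by (auto simp: ring_hom_fun_def)
  from ring_hom_fun_comp[OF this ring_hom_uni, of x] have "poly (uni x p) (mvar x) = (\<lambda>p. p) p"
    by (rule ring_hom_eqI) (auto simp: ring_hom_fun_def uni_mconst uni_mvar)
  then show ?thesis by simp
qed

lemma uni_eq_0_iff [simp]: "uni x p = 0 \<longleftrightarrow> p = 0"
  by (metis poly_0 poly_uni uni_simps(1))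

lemma uni_const: "x \<notin> mvars p \<Longrightarrow> uni x p = [:p:]"
  by (rule ring_hom_eqI[OF ring_hom_uni ring_hom_pCons]) (auto simp: uni_mconst uni_mvar)

text \<open>The univariate polynomials with coefficients in \<open>?B\<close> form a ring containing
  the images of the constants and of the variables of \<open>p\<close>, hence the image of
  \<open>p\<close>.\<close>

lemma mvars_coeff_uni: "mvars (Polynomial.coeff (uni x p) k) \<subseteq> mvars p - {x}"
proof -
  let ?B = "{q :: ('a, 'b) mpoly. mvars q \<subseteq> mvars p - {x}}"
  let ?S = "{P. \<forall>k. Polynomial.coeff P k \<in> ?B}"
  have add: "a + b \<in> ?B" if "a \<in> ?B" "b \<in> ?B" for a b
    using mvars_add[of a b] that by blast
  have mult: "a * b \<in> ?B" if "a \<in> ?B" "b \<in> ?B" for a b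
    using mvars_mult[of a b] that by blast
  have "uni x p \<in> ?S"
    unfolding uni_def
  proof (rule meval_closed)
    fix a b assume a: "a \<in> ?S" and b: "b \<in> ?S"
    show "a + b \<in> ?S" using a b add by simp
    have "Polynomial.coeff (a * b) k \<in> ?B" for k
      unfolding coeff_mult using a b by (intro sum_closed add mult) auto
    then show "a * b \<in> ?S" by blast
  next
    fix v assume "v \<in> mvars p"
    then show "(if v = x then [:0, 1:] else [:mvar v:]) \<in> ?S"
      by (auto simp: coeff_pCons split: nat.splits if_splits)
  qed (auto simp: coeff_pCons split: nat.splits)
  then show ?thesis by blast
qed

lemma degree_uni_eq_0_iff: "degree (uni x p) = 0 \<longleftrightarrow> x \<notin> mvars p"
proof
  assume "degree (uni x p) = 0"
  then obtain c where c: "uni x p = [:c:]" by (rule degree_eq_zeroE)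
  then have "c = p" using poly_uni[of x p] by simp
  then show "x \<notin> mvars p" using mvars_coeff_uni[of x p 0] c by auto
qed (simp add: uni_const)

lemma degree_uni_mult:
  fixes p q :: "('v::linorder, 'a::idom) mpoly"
  shows "p \<noteq> 0 \<Longrightarrow> q \<noteq> 0 \<Longrightarrow> degree (uni x (p * q)) = degree (uni x p) + degree (uni x q)"
  by (simp add: uni_simps degree_mult_eq)

text \<open>Over a domain the degrees in each variable add up, and a variable occurs exactly when
  its degree is positive. This keeps the factors of a nonzero element of a polynomial subring inside
  that subring.\<close>

lemma mvars_mult_eq:
  fixes p q :: "('v::linorder, 'a::idom) mpoly"
  assumes "p \<noteq> 0" "q \<noteq> 0"
  shows "mvars (p * q) = mvars p \<union> mvars q"
proof -
  have "v \<in> mvars (p * q) \<longleftrightarrow> v \<in> mvars p \<or> v \<in> mvars q" for v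
    using degree_uni_mult[OF assms, of v] degree_uni_eq_0_iff[of v p] degree_uni_eq_0_iff[of v q]
      degree_uni_eq_0_iff[of v "p * q"] by linarith
  then show ?thesis by blast
qed

section \<open>Units and factorization into irreducibles\<close>

lemma unit_cofactor_dvd:
  fixes u :: "'a::comm_semiring_1"
  assumes "u dvd 1" "f = u * g"
  shows "f dvd g"
proof -
  obtain e where "1 = u * e" using assms(1) by (rule dvdE)
  then have "g = (u * e) * g" by simp
  then have "g = f * e" using assms(2) by (simp add: ac_simps)
  then show ?thesis by simp
qed

lemma mpoly_unit_iff:
  fixes p :: "('v::linorder, 'a::field) mpoly"
  shows "p dvd 1 \<longleftrightarrow> p \<noteq> 0 \<and> mvars p = {}"
proof
  assume "p dvd 1"
  then obtain q where q: "1 = p * q" by auto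
  then have "p \<noteq> 0" "q \<noteq> 0" by auto
  then show "p \<noteq> 0 \<and> mvars p = {}" using mvars_mult_eq[of p q] q[symmetric] by auto
next
  assume *: "p \<noteq> 0 \<and> mvars p = {}"
  then obtain c where "p = mconst c" by (auto simp: mvars_empty_iff)
  with * have "p * mconst (inverse c) = 1" by (auto simp flip: mconst_mult)
  then show "p dvd 1" by (metis dvdI)
qed

text \<open>Existence of factorizations into irreducibles, cast as an induction rule. The sum of the
  degrees in the variables of \<open>c\<close> is additive on products and positive on nonunits, so
  it drops from a product to both proper factors.\<close>

lemma mpoly_factor_induct [consumes 1, case_names unit irreducible mult]:
  fixes c :: "('v::linorder, 'a::field) mpoly"
  assumes "c \<noteq> 0"
    and unit: "\<And>u. u dvd 1 \<Longrightarrow> P u"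
    and irr: "\<And>p. Factorial_Ring.irreducible p \<Longrightarrow> mvars p \<subseteq> mvars c \<Longrightarrow> P p"
    and mult: "\<And>a b. P a \<Longrightarrow> P b \<Longrightarrow> P (a * b)"
  shows "P c"
proof -
  let ?td = "\<lambda>p. \<Sum>v\<in>mvars c. degree (uni v p)"
  have "P p" if "p \<noteq> 0" "mvars p \<subseteq> mvars c" for p
    using that
  proof (induction "?td p" arbitrary: p rule: less_induct)
    case less
    consider "p dvd 1" | "Factorial_Ring.irreducible p" | a b where "p = a * b" "\<not> a dvd 1" "\<not> b dvd 1"
      using less.prems(1) by (auto simp: Factorial_Ring.irreducible_def)
    then show ?case
    proof cases
      case 3
      then have nz: "a \<noteq> 0" "b \<noteq> 0" using less.prems by auto
      have sub: "mvars a \<subseteq> mvars c" "mvars b \<subseteq> mvars c"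
        using mvars_mult_eq[OF nz] 3 less.prems by auto
      have td: "?td p = ?td a + ?td b"
        unfolding 3 by (simp add: degree_uni_mult nz sum.distrib)
      have pos: "0 < ?td q" if "\<not> q dvd 1" "q \<noteq> 0" "mvars q \<subseteq> mvars c" for q :: "('v, 'a) mpoly"
      proof -
        have "mvars q \<noteq> {}" using that mpoly_unit_iff[of q] by simp
        then obtain v where "v \<in> mvars q" by blast
        then have "v \<in> mvars c" "0 < degree (uni v q)"
          using that degree_uni_eq_0_iff[of v q] by auto
        then show ?thesis by (simp add: sum_pos2)
      qed
      have "P a" "P b"
        using less.hyps[of a] less.hyps[of b] nz sub td pos[of a] pos[of b] 3 by auto
      then show ?thesis using 3 mult by blast
    qed (use unit irr less.prems in auto)
  qed
  then show ?thesis using assms(1) by blast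
qed

text \<open>Divisibility is that of the full ring, but the factors tested have variables in
  \<open>V\<close> only. This relative form permits adjoining one variable at a time.\<close>

definition prime_on :: "'v set \<Rightarrow> ('v, 'a::comm_ring_1) mpoly \<Rightarrow> bool" where
  "prime_on V p \<longleftrightarrow> (\<forall>a b. mvars a \<subseteq> V \<longrightarrow> mvars b \<subseteq> V \<longrightarrow> p dvd a * b \<longrightarrow> p dvd a \<or> p dvd b)"

text \<open>An \<open>x\<close>-free \<open>p\<close> becomes a constant polynomial under
  \<open>uni x\<close>, and divisibility by a constant is coefficientwise.\<close>

lemma dvd_iff_coeff_uni:
  assumes "x \<notin> mvars p"
  shows "p dvd a \<longleftrightarrow> (\<forall>k. p dvd Polynomial.coeff (uni x a) k)"
proof
  assume "p dvd a"
  then obtain b where "a = p * b" by (rule dvdE)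
  then have "uni x a = Polynomial.smult p (uni x b)" by (simp add: uni_simps(4) uni_const[OF assms])
  then show "\<forall>k. p dvd Polynomial.coeff (uni x a) k" by simp
next
  assume "\<forall>k. p dvd Polynomial.coeff (uni x a) k"
  then have "p dvd poly (uni x a) (mvar x)"
    unfolding poly_altdef by (intro dvd_sum dvd_mult2) auto
  then show "p dvd a" by (simp add: poly_uni)
qed

text \<open>If \<open>i\<close> and \<open>j\<close> are the least orders of coefficients of
  \<open>a\<close> and \<open>b\<close> not divisible by \<open>p\<close>, then the coefficient of
  order \<open>i + j\<close> in the product is congruent modulo \<open>p\<close> to the product of
  these two, hence not divisible either.\<close>

lemma prime_on_insert:
  assumes p: "mvars p \<subseteq> V" "prime_on V p" and x: "x \<notin> V"
  shows "prime_on (insert x V) p"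
  unfolding prime_on_def
proof (intro allI impI)
  fix a b assume ab: "mvars a \<subseteq> insert x V" "mvars b \<subseteq> insert x V" "p dvd a * b"
  have xp: "x \<notin> mvars p" using p x by auto
  show "p dvd a \<or> p dvd b"
  proof (rule ccontr)
    assume "\<not> (p dvd a \<or> p dvd b)"
    then have ex: "\<exists>i. \<not> p dvd Polynomial.coeff (uni x a) i" "\<exists>j. \<not> p dvd Polynomial.coeff (uni x b) j"
      using dvd_iff_coeff_uni[OF xp, of a] dvd_iff_coeff_uni[OF xp, of b] by blast+
    define i where "i = (LEAST i. \<not> p dvd Polynomial.coeff (uni x a) i)"
    define j where "j = (LEAST j. \<not> p dvd Polynomial.coeff (uni x b) j)"
    have i: "\<not> p dvd Polynomial.coeff (uni x a) i" "\<And>k. k < i \<Longrightarrow> p dvd Polynomial.coeff (uni x a) k"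
      unfolding i_def using LeastI_ex[OF ex(1)] not_less_Least by auto
    have j: "\<not> p dvd Polynomial.coeff (uni x b) j" "\<And>k. k < j \<Longrightarrow> p dvd Polynomial.coeff (uni x b) k"
      unfolding j_def using LeastI_ex[OF ex(2)] not_less_Least by auto
    let ?s = "\<Sum>k\<in>{..i + j} - {i}. Polynomial.coeff (uni x a) k * Polynomial.coeff (uni x b) (i + j - k)"
    have 1: "p dvd Polynomial.coeff (uni x a * uni x b) (i + j)"
      using ab(3) dvd_iff_coeff_uni[OF xp, of "a * b"] unfolding uni_simps(4) by blast
    have 2: "Polynomial.coeff (uni x a * uni x b) (i + j) =
      Polynomial.coeff (uni x a) i * Polynomial.coeff (uni x b) j + ?s"
      unfolding coeff_mult by (subst sum.remove[of _ i]) auto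
    have 3: "p dvd ?s"
    proof (rule dvd_sum)
      fix k assume k: "k \<in> {..i + j} - {i}"
      show "p dvd Polynomial.coeff (uni x a) k * Polynomial.coeff (uni x b) (i + j - k)"
      proof (cases "k < i")
        case True
        then show ?thesis by (intro dvd_mult2 i(2))
      next
        case False
        then have "i + j - k < j" using k by auto
        then show ?thesis by (intro dvd_mult j(2))
      qed
    qed
    have "p dvd Polynomial.coeff (uni x a) i * Polynomial.coeff (uni x b) j"
      using 1 unfolding 2 dvd_add_left_iff[OF 3] .
    moreover have "mvars (Polynomial.coeff (uni x a) i) \<subseteq> V" "mvars (Polynomial.coeff (uni x b) j) \<subseteq> V"
      using mvars_coeff_uni[of x a i] mvars_coeff_uni[of x b j] ab by auto
    ultimately show False using p(2) i(1) j(1) unfolding prime_on_def by blast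
  qed
qed

text \<open>The irreducible factors of \<open>c\<close> are prime relative to \<open>W\<close>, so
  each of them can be cancelled against either \<open>q\<close> or \<open>d\<close>. What remains of
  \<open>q\<close> and \<open>d\<close> is a factorization of \<open>f\<close>.\<close>

lemma cofactor_split:
  fixes c f q d :: "('v::linorder, 'a::field) mpoly"
  assumes IH: "\<And>p :: ('v, 'a) mpoly. Factorial_Ring.irreducible p \<Longrightarrow> mvars p \<subseteq> V \<Longrightarrow> prime_on W p"
    and "c \<noteq> 0" "mvars c \<subseteq> V" "c * f = q * d" "f \<noteq> 0" "mvars q \<subseteq> W" "mvars d \<subseteq> W"
  shows "\<exists>c\<^sub>1 c\<^sub>2 q' d'. c = c\<^sub>1 * c\<^sub>2 \<and> q = c\<^sub>1 * q' \<and> d = c\<^sub>2 * d' \<and> f = q' * d'"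
proof -
  \<comment> \<open>The predicate quantifies over \<open>f\<close>, \<open>q\<close> and
    \<open>d\<close>, which change when a factor is cancelled, and carries
    \<open>c \<noteq> 0\<close>, which keeps the intermediate products nonzero.\<close>
  have "c \<noteq> 0 \<and> (\<forall>f q d. f \<noteq> 0 \<longrightarrow> c * f = q * d \<longrightarrow> mvars q \<subseteq> W \<longrightarrow> mvars d \<subseteq> W \<longrightarrow>
    (\<exists>c\<^sub>1 c\<^sub>2 q' d'. c = c\<^sub>1 * c\<^sub>2 \<and> q = c\<^sub>1 * q' \<and> d = c\<^sub>2 * d' \<and> f = q' * d'))"
    using assms(2)
  proof (induction rule: mpoly_factor_induct)
    case (unit u)
    then obtain e where e: "u * e = 1" by (metis dvdE)
    have "u = u * 1 \<and> q = u * (e * q) \<and> d = 1 * d \<and> f = (e * q) * d" if "u * f = q * d" for f q d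
    proof (intro conjI)
      show "q = u * (e * q)" by (simp add: e mult.assoc[symmetric])
      have "f = (u * e) * f" using e by simp
      also have "\<dots> = e * (u * f)" by (simp add: ac_simps)
      finally show "f = (e * q) * d" using that by (simp add: mult.assoc)
    qed auto
    moreover have "u \<noteq> 0" using e by auto
    ultimately show ?case by blast
  next
    case (irreducible p)
    have pr: "prime_on W p" by (intro IH irreducible(1) order_trans[OF irreducible(2)] assms(3))
    have p0: "p \<noteq> 0" using irreducible by auto
    show ?case
    proof (intro conjI p0 allI impI)
      fix f q d assume *: "p * f = q * d" "mvars q \<subseteq> W" "mvars d \<subseteq> W"
      then have "p dvd q * d" by (metis dvd_triv_left)
      then have "p dvd q \<or> p dvd d" using pr * unfolding prime_on_def by blast
      then consider q' where "q = p * q'" | d' where "d = p * d'" by auto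
      then show "\<exists>c\<^sub>1 c\<^sub>2 q' d'. p = c\<^sub>1 * c\<^sub>2 \<and> q = c\<^sub>1 * q' \<and> d = c\<^sub>2 * d' \<and> f = q' * d'"
      proof cases
        case 1
        then have "f = q' * d" using * p0 by (simp add: mult.assoc)
        then have "p = p * 1 \<and> q = p * q' \<and> d = 1 * d \<and> f = q' * d" using 1 by simp
        then show ?thesis by blast
      next
        case 2
        then have "f = q * d'" using * p0 by (simp add: mult.left_commute)
        then have "p = 1 * p \<and> q = 1 * q \<and> d = p * d' \<and> f = q * d'" using 2 by simp
        then show ?thesis by blast
      qed
    qed
  next
    case (mult a b)
    show ?case
    proof (intro conjI allI impI)
      show "a * b \<noteq> 0" using mult by simp
      fix f q d assume *: "f \<noteq> 0" "a * b * f = q * d" "mvars q \<subseteq> W" "mvars d \<subseteq> W"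
      then have "b * f \<noteq> 0" "a * (b * f) = q * d" using mult by (auto simp: mult.assoc)
      then obtain a1 a2 q1 d1 where a: "a = a1 * a2" "q = a1 * q1" "d = a2 * d1" "b * f = q1 * d1"
        using mult(1) * by metis
      have "q \<noteq> 0" "d \<noteq> 0" using \<open>b * f \<noteq> 0\<close> a mult by auto
      then have "mvars q1 \<subseteq> W" "mvars d1 \<subseteq> W"
        using mvars_mult_eq[of a1 q1] mvars_mult_eq[of a2 d1] a * by auto
      then obtain b1 b2 q' d' where b: "b = b1 * b2" "q1 = b1 * q'" "d1 = b2 * d'" "f = q' * d'"
        using mult(2) a(4) *(1) by metis
      have "a * b = (a1 * b1) * (a2 * b2) \<and> q = (a1 * b1) * q' \<and> d = (a2 * b2) * d' \<and> f = q' * d'"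
        using a b by (simp add: ac_simps)
      then show "\<exists>c\<^sub>1 c\<^sub>2 q' d'. a * b = c\<^sub>1 * c\<^sub>2 \<and> q = c\<^sub>1 * q' \<and> d = c\<^sub>2 * d' \<and> f = q' * d'" by blast
    qed
  qed
  then show ?thesis using assms by blast
qed

text \<open>The coefficients in \<open>x\<close> do not form a field, so each removal of a leading
  term first multiplies \<open>e\<close> by the leading coefficient of \<open>d\<close>. These
  multipliers accumulate in the \<open>x\<close>-free factor \<open>c\<close>.\<close>

lemma pseudo_division_uni:
  fixes d e :: "('v::linorder, 'a::field) mpoly"
  assumes "d \<noteq> 0" "mvars d \<subseteq> insert x V" "mvars e \<subseteq> insert x V" "x \<notin> V"
  shows "\<exists>c q. c \<noteq> 0 \<and> mvars c \<subseteq> V \<and> mvars q \<subseteq> insert x V \<and>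
    (c * e - q * d = 0 \<or> degree (uni x (c * e - q * d)) < degree (uni x d))"
  using assms(3)
\<comment> \<open>The measure puts the zero polynomial, whose \<open>degree\<close> is 0, strictly
  below the nonzero polynomials of degree 0 in \<open>x\<close>.\<close>
proof (induction "if e = 0 then 0 else Suc (degree (uni x e))" arbitrary: e rule: less_induct)
  case less
  show ?case
  proof (cases "e = 0 \<or> degree (uni x e) < degree (uni x d)")
    case True
    then show ?thesis by (intro exI[of _ 1] exI[of _ 0]) auto
  next
    case False
    define a where "a = lead_coeff (uni x d)"
    define b where "b = lead_coeff (uni x e)"
    define k where "k = degree (uni x e) - degree (uni x d)"
    define e' where "e' = a * e - b * mvar x ^ k * d"
    have va: "mvars a \<subseteq> V" "mvars b \<subseteq> V"
      using mvars_coeff_uni assms(2) less.prems unfolding a_def b_def by fastforce+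
    have a0: "a \<noteq> 0" using assms(1) by (simp add: a_def)
    have xk: "mvars (mvar x ^ k :: ('v, 'a) mpoly) \<subseteq> {x}"
      by (induction k) (auto dest!: mvars_mult[THEN subsetD])
    have vbk: "mvars (b * mvar x ^ k) \<subseteq> insert x V"
      using mvars_mult[of b "mvar x ^ k"] va xk by auto
    have ve': "mvars e' \<subseteq> insert x V"
      using mvars_diff[of "a * e" "b * mvar x ^ k * d"] mvars_mult[of a e] mvars_mult[of "b * mvar x ^ k" d]
        va vbk less.prems assms(2) unfolding e'_def by blast
    have ue': "uni x e' = Polynomial.smult a (uni x e) - Polynomial.smult b (Polynomial.monom 1 k * uni x d)"
    proof -
      have "uni x a = [:a:]" "uni x b = [:b:]" using va assms(4) by (auto intro!: uni_const)
      moreover have "uni x (mvar x ^ k) = (Polynomial.monom 1 k :: ('v, 'a) mpoly poly)"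
        by (simp add: uni_simps uni_mvar monom_altdef)
      ultimately show ?thesis unfolding e'_def by (simp add: uni_simps)
    qed
    have "degree (uni x e') \<le> degree (uni x e)"
      unfolding ue' using False
      by (intro degree_diff_le) (auto simp: k_def degree_smult_eq degree_mult_eq assms(1) degree_monom_eq)
    moreover have "Polynomial.coeff (uni x e') (degree (uni x e)) = 0"
    proof -
      have "Polynomial.coeff (Polynomial.monom 1 k * uni x d) (degree (uni x e)) = a"
        using False by (simp add: coeff_monom_mult k_def a_def)
      then show ?thesis unfolding ue' coeff_diff coeff_smult by (simp add: b_def)
    qed
    ultimately have "e' = 0 \<or> degree (uni x e') < degree (uni x e)"
      using eq_zero_or_degree_less uni_eq_0_iff by metis
    then have "(if e' = 0 then 0 else Suc (degree (uni x e'))) < (if e = 0 then 0 else Suc (degree (uni x e)))"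
      using False by auto
    from less.hyps[OF this ve'] obtain c q where cq: "c \<noteq> 0" "mvars c \<subseteq> V" "mvars q \<subseteq> insert x V"
      "c * e' - q * d = 0 \<or> degree (uni x (c * e' - q * d)) < degree (uni x d)"
      by blast
    have eq: "(c * a) * e - (q + c * (b * mvar x ^ k)) * d = c * e' - q * d"
      by (simp add: e'_def algebra_simps)
    have "mvars (c * a) \<subseteq> V" using mvars_mult[of c a] cq va by blast
    moreover have "mvars (q + c * (b * mvar x ^ k)) \<subseteq> insert x V"
      using mvars_add[of q "c * (b * mvar x ^ k)"] mvars_mult[of c "b * mvar x ^ k"] cq vbk by blast
    moreover have "c * a \<noteq> 0" using cq a0 by simp
    ultimately show ?thesis using eq cq(4) by metis
  qed
qed

text \<open>Gauss's argument: a nonzero \<open>d\<close> of minimal degree in the ideal \<open>(f, g)\<close> divides both \<open>f\<close> and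
  \<open>g\<close> up to coefficients free of \<open>x\<close>; irreducibility of \<open>f\<close> makes \<open>d\<close> essentially \<open>f\<close> or free of \<open>x\<close>.\<close>

lemma irreducible_prime_on_insert:
  fixes f :: "('v::linorder, 'a::field) mpoly"
  assumes IH: "\<And>p :: ('v, 'a) mpoly. Factorial_Ring.irreducible p \<Longrightarrow> mvars p \<subseteq> V \<Longrightarrow> prime_on V p"
    and x: "x \<notin> V" and f: "Factorial_Ring.irreducible f" "mvars f \<subseteq> insert x V"
  shows "prime_on (insert x V) f"
proof (cases "x \<in> mvars f")
  case False
  then show ?thesis using prime_on_insert[OF _ IH x] f by blast
next
  case xf: True
  let ?W = "insert x V"
  have IHW: "prime_on ?W p" if "Factorial_Ring.irreducible p" "mvars p \<subseteq> V" for p :: "('v, 'a) mpoly"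
    using prime_on_insert[OF _ IH x] that by blast
  have f0: "f \<noteq> 0" using f by auto
  \<comment> \<open>Distribute the factors of \<open>c\<close> over \<open>f\<close> and its
    cofactor \<open>e\<close>. The part \<open>c1\<close> that goes into \<open>f\<close> is free of
    \<open>x\<close>, so \<open>x\<close> sits in the complementary factor \<open>f'\<close>; that
    one is no unit and irreducibility makes \<open>c1\<close> a unit.\<close>
  have cancel: "f dvd h" if c: "c \<noteq> 0" "mvars c \<subseteq> V" and h: "mvars h \<subseteq> ?W" and dvd: "f dvd c * h" for c h
  proof (cases "h = 0")
    case False
    obtain e where e: "c * h = f * e" using dvd by auto
    have "e \<noteq> 0" using e c False by auto
    then have "mvars e \<subseteq> ?W" using mvars_mult_eq[of c h] mvars_mult_eq[of f e] e c h f0 False by auto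
    then obtain c1 c2 f' e' where *: "c = c1 * c2" "f = c1 * f'" "e = c2 * e'" "h = f' * e'"
      using cofactor_split[OF IHW c e False f(2)] \<open>mvars e \<subseteq> ?W\<close> by blast
    have "\<not> f' dvd 1"
    proof
      assume "f' dvd 1"
      then have "mvars f' = {}" by (simp add: mpoly_unit_iff)
      moreover have "mvars c1 \<subseteq> V" using mvars_mult_eq[of c1 c2] * c by auto
      ultimately show False using mvars_mult[of c1 f'] *(2) xf x by auto
    qed
    then have "c1 dvd 1" using f(1) *(2) \<open>\<not> f' dvd 1\<close> unfolding Factorial_Ring.irreducible_def by blast
    then have "f dvd f'" using *(2) by (rule unit_cofactor_dvd)
    then show ?thesis using *(4) by auto
  qed auto
  show ?thesis
    unfolding prime_on_def
  proof (intro allI impI)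
    fix g h assume g: "mvars g \<subseteq> ?W" and h: "mvars h \<subseteq> ?W" and gh: "f dvd g * h"
    define I where "I = {a * f + b * g | a b. mvars a \<subseteq> ?W \<and> mvars b \<subseteq> ?W}"
    have fI: "f \<in> I" unfolding I_def by (rule CollectI, rule exI[of _ 1], rule exI[of _ 0]) auto
    have gI: "g \<in> I" unfolding I_def by (rule CollectI, rule exI[of _ 0], rule exI[of _ 1]) auto
    obtain d where d: "d \<in> I" "d \<noteq> 0" "\<And>e. e \<in> I \<Longrightarrow> e \<noteq> 0 \<Longrightarrow> degree (uni x d) \<le> degree (uni x e)"
      using ex_has_least_nat[of "\<lambda>d. d \<in> I \<and> d \<noteq> 0" f "\<lambda>d. degree (uni x d)"] fI f0 by auto
    obtain a b where ab: "d = a * f + b * g" "mvars a \<subseteq> ?W" "mvars b \<subseteq> ?W"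
      using d(1) unfolding I_def by blast
    have IW: "mvars e \<subseteq> ?W" if "e \<in> I" for e
    proof -
      obtain a b where "e = a * f + b * g" "mvars a \<subseteq> ?W" "mvars b \<subseteq> ?W"
        using \<open>e \<in> I\<close> unfolding I_def by blast
      then show ?thesis
        using f(2) g mvars_add[of "a * f" "b * g"] mvars_mult[of a f] mvars_mult[of b g] by blast
    qed
    have div: "\<exists>c q. c \<noteq> 0 \<and> mvars c \<subseteq> V \<and> mvars q \<subseteq> ?W \<and> c * e = q * d" if e: "e \<in> I" for e
    proof -
      obtain c q where cq: "c \<noteq> 0" "mvars c \<subseteq> V" "mvars q \<subseteq> ?W"
        "c * e - q * d = 0 \<or> degree (uni x (c * e - q * d)) < degree (uni x d)"
        using pseudo_division_uni[OF d(2) IW[OF d(1)] IW[OF e] x] by blast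
      obtain a' b' where ab': "e = a' * f + b' * g" "mvars a' \<subseteq> ?W" "mvars b' \<subseteq> ?W"
        using e unfolding I_def by blast
      have "c * e - q * d = (c * a' - q * a) * f + (c * b' - q * b) * g"
        unfolding ab'(1) ab(1) by (simp add: algebra_simps)
      moreover have "mvars (c * a' - q * a) \<subseteq> ?W" "mvars (c * b' - q * b) \<subseteq> ?W"
        using ab' ab cq mvars_diff[of "c * a'" "q * a"] mvars_mult[of c a'] mvars_mult[of q a]
          mvars_diff[of "c * b'" "q * b"] mvars_mult[of c b'] mvars_mult[of q b] by blast+
      ultimately have "c * e - q * d \<in> I" unfolding I_def by blast
      \<comment> \<open>The pseudo-remainder lies in \<open>I\<close> again, and the minimal degree
        of \<open>d\<close> leaves only 0.\<close>
      then have "c * e - q * d = 0" using cq(4) d(3) not_less by blast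
      then show ?thesis using cq by auto
    qed
    obtain c q where cq: "c \<noteq> 0" "mvars c \<subseteq> V" "mvars q \<subseteq> ?W" "c * f = q * d" using div[OF fI] by blast
    obtain c1 c2 q' d' where *: "c = c1 * c2" "q = c1 * q'" "d = c2 * d'" "f = q' * d'"
      using cofactor_split[OF IHW cq(1,2,4) f0 cq(3) IW[OF d(1)]] by blast
    have c2: "c2 \<noteq> 0" "mvars c2 \<subseteq> V" using mvars_mult_eq[of c1 c2] cq * by auto
    have "q' dvd 1 \<or> d' dvd 1" using f(1) *(4) unfolding Factorial_Ring.irreducible_def by blast
    then show "f dvd g \<or> f dvd h"
    proof
      \<comment> \<open>Here \<open>f\<close> divides \<open>d\<close>, and \<open>d\<close> divides
        \<open>g\<close> up to an \<open>x\<close>-free factor.\<close>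
      assume "q' dvd 1"
      then have "f dvd d'" using *(4) by (rule unit_cofactor_dvd)
      then have fd: "f dvd d" using *(3) by simp
      obtain c' q2 where c': "c' \<noteq> 0" "mvars c' \<subseteq> V" "c' * g = q2 * d" using div[OF gI] by blast
      have "f dvd c' * g" unfolding c'(3) by (rule dvd_mult[OF fd])
      then have "f dvd g" by (rule cancel[OF c'(1,2) g])
      then show ?thesis ..
    next
      \<comment> \<open>Here \<open>d\<close> is associated with \<open>c2\<close> and so free of
        \<open>x\<close>. From \<open>d = a * f + b * g\<close> and \<open>f dvd g * h\<close>
        follows \<open>f dvd c2 * h\<close>, and \<open>cancel\<close> drops
        \<open>c2\<close>.\<close>
      assume "d' dvd 1"
      have "d * h = f * (a * h) + b * (g * h)" unfolding ab(1) by (simp add: algebra_simps)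
      moreover have "f dvd f * (a * h) + b * (g * h)" by (intro dvd_add dvd_triv_left dvd_mult gh)
      ultimately have "f dvd d * h" by simp
      moreover have "d * h dvd c2 * h"
        using unit_cofactor_dvd[OF \<open>d' dvd 1\<close>, of d c2] *(3) by (simp add: mult.commute mult_dvd_mono)
      ultimately have "f dvd c2 * h" by (rule dvd_trans)
      then show ?thesis using cancel[OF c2 h] by simp
    qed
  qed
qed

text \<open>Only the finitely many variables of \<open>p\<close>, \<open>a\<close> and
  \<open>b\<close> matter, so induction over finite sets of variables suffices. It starts because
  nonzero constants are units and there is no irreducible without variables.\<close>

lemma irreducible_imp_prime_elem_mpoly:
  fixes p :: "('v::linorder, 'a::field) mpoly"
  assumes "Factorial_Ring.irreducible p"
  shows "prime_elem p"
proof -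
  have prime: "prime_on V p" if "finite V" "Factorial_Ring.irreducible p" "mvars p \<subseteq> V" for V and p :: "('v, 'a) mpoly"
    using that
  proof (induction V arbitrary: p rule: finite_induct)
    case empty
    then have "p dvd 1" using mpoly_unit_iff[of p] Factorial_Ring.irreducible_def[of p] by blast
    then show ?case using empty Factorial_Ring.irreducible_def[of p] by blast
  next
    case (insert x V)
    show ?case
      by (rule irreducible_prime_on_insert) (use insert in auto)
  qed
  have "p dvd a \<or> p dvd b" if "p dvd a * b" for a b
  proof -
    have "prime_on (mvars p \<union> mvars a \<union> mvars b) p"
      by (rule prime) (use assms in auto)
    then show ?thesis using that by (auto simp: prime_on_def)
  qed
  then show ?thesis using assms unfolding prime_elem_def Factorial_Ring.irreducible_def by blast
qed

section \<open>Subrings and codimension one\<close>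

text \<open>The records built by \<open>subring_on\<close> inherit the type-class operations.
  Closure of a plain set is thus all that is needed to work with ideals in the record-based
  sense.\<close>

locale subring_set =
  fixes S :: "'a::comm_ring_1 set"
  assumes one: "1 \<in> S" and uminus: "\<And>a. a \<in> S \<Longrightarrow> - a \<in> S"
    and add: "\<And>a b. a \<in> S \<Longrightarrow> b \<in> S \<Longrightarrow> a + b \<in> S"
    and mult: "\<And>a b. a \<in> S \<Longrightarrow> b \<in> S \<Longrightarrow> a * b \<in> S"
begin

lemma zero: "0 \<in> S"
  using add[OF one uminus[OF one]] by simp

lemma diff: "a \<in> S \<Longrightarrow> b \<in> S \<Longrightarrow> a - b \<in> S"
  using add[of a "- b"] uminus[of b] by simp

lemma cring_subring_on: "cring (subring_on S)"
proof (rule cringI)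
  show "abelian_group (subring_on S)"
  proof (rule abelian_groupI)
    fix x assume "x \<in> carrier (subring_on S)"
    then have "- x \<in> carrier (subring_on S)" "- x \<oplus>\<^bsub>subring_on S\<^esub> x = \<zero>\<^bsub>subring_on S\<^esub>"
      by (simp_all add: subring_on_def uminus)
    then show "\<exists>y\<in>carrier (subring_on S). y \<oplus>\<^bsub>subring_on S\<^esub> x = \<zero>\<^bsub>subring_on S\<^esub>" by blast
  qed (simp_all add: subring_on_def add zero add_ac)
  show "Group.comm_monoid (subring_on S)"
    by (rule comm_monoidI) (simp_all add: subring_on_def mult one mult_ac)
qed (simp add: subring_on_def algebra_simps)

lemma ideal_subring_onI:
  assumes "I \<subseteq> S" "0 \<in> I" "\<And>a b. a \<in> I \<Longrightarrow> b \<in> I \<Longrightarrow> a + b \<in> I"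
    and "\<And>a x. a \<in> I \<Longrightarrow> x \<in> S \<Longrightarrow> x * a \<in> I"
  shows "ideal I (subring_on S)"
proof -
  interpret cring "subring_on S" by (rule cring_subring_on)
  have neg: "- a \<in> I" if "a \<in> I" for a
    using assms(4)[OF that uminus[OF one]] by simp
  have "subgroup I (add_monoid (subring_on S))"
  proof (rule add.subgroupI)
    fix a assume a: "a \<in> I"
    have "\<ominus>\<^bsub>subring_on S\<^esub> a = - a"
      by (rule minus_equality) (use a assms(1) uminus in \<open>auto simp: subring_on_def\<close>)
    then show "\<ominus>\<^bsub>subring_on S\<^esub> a \<in> I"
      using neg[OF a] by simp
  qed (use assms in \<open>auto simp: subring_on_def\<close>)
  then show ?thesis
    by (intro idealI) (use assms ring_axioms in \<open>auto simp: subring_on_def mult.commute\<close>)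
qed

end

lemma ideal_subring_onD:
  assumes "ideal I (subring_on S)"
  shows "I \<subseteq> S" "0 \<in> I" "a \<in> I \<Longrightarrow> b \<in> I \<Longrightarrow> a + b \<in> I" "a \<in> I \<Longrightarrow> x \<in> S \<Longrightarrow> x * a \<in> I"
    "a \<in> I \<Longrightarrow> x \<in> S \<Longrightarrow> a * x \<in> I"
proof -
  interpret ideal I "subring_on S" by fact
  show "I \<subseteq> S" using a_subset by (simp add: subring_on_def)
  show "0 \<in> I" using additive_subgroup.zero_closed[OF additive_subgroup_axioms] by (simp add: subring_on_def)
  show "a \<in> I \<Longrightarrow> b \<in> I \<Longrightarrow> a + b \<in> I" using additive_subgroup.a_closed[OF additive_subgroup_axioms, of a b] by (simp add: subring_on_def)
  show "a \<in> I \<Longrightarrow> x \<in> S \<Longrightarrow> x * a \<in> I" using I_l_closed[of a x] by (simp add: subring_on_def)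
  show "a \<in> I \<Longrightarrow> x \<in> S \<Longrightarrow> a * x \<in> I" using I_r_closed[of a x] by (simp add: subring_on_def)
qed

lemma subring_set_mvars:
  "subring_set {p :: ('v \<Rightarrow>\<^sub>0 'e::comm_monoid_add) \<Rightarrow>\<^sub>0 'a::comm_ring_1. mvars p \<subseteq> V}"
  by unfold_locales (auto dest!: mvars_add[THEN subsetD] mvars_mult[THEN subsetD])

lemma carrier_poly_ring: "carrier (poly_ring V) = {p. mvars p \<subseteq> V}"
  by (simp add: poly_ring_def subring_on_def)

text \<open>No variable cancels in a nonzero product, so factors of \<open>p\<close> and inverses of
  units taken in the full ring already lie in \<open>poly_ring V\<close>; the two notions of unit
  and of factor agree there.\<close>

lemma ring_irreducible_poly_ring:
  fixes p :: "('v::linorder, 'a::field) mpoly"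
  assumes p: "p \<in> carrier (poly_ring V)" "ring_irreducible\<^bsub>poly_ring V\<^esub> p"
  shows "Factorial_Ring.irreducible p"
proof -
  let ?R = "poly_ring V :: ('v, 'a) mpoly ring"
  have zero: "\<zero>\<^bsub>?R\<^esub> = 0" by (simp add: poly_ring_def subring_on_def)
  have p0: "p \<noteq> 0" and nu: "p \<notin> Units ?R"
    and irr: "\<And>b. b \<in> carrier ?R \<Longrightarrow> properfactor ?R b p \<Longrightarrow> b \<in> Units ?R"
    using p(2) unfolding ring_irreducible_def Divisibility.irreducible_def zero by blast+
  have closed: "a \<in> carrier ?R \<and> b \<in> carrier ?R" if "a * b \<in> carrier ?R" "a * b \<noteq> 0" for a b
    using that mvars_mult_eq[of a b] by (cases "a = 0 \<or> b = 0") (auto simp: carrier_poly_ring)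
  have one: "1 \<in> carrier ?R" by (simp add: carrier_poly_ring)
  have units: "a \<in> Units ?R" if "a dvd 1" for a
  proof -
    obtain b where b: "1 = a * b" using \<open>a dvd 1\<close> by (rule dvdE)
    then have "a * b \<in> carrier ?R" "a * b \<noteq> 0" using one by auto
    then have "a \<in> carrier ?R" "b \<in> carrier ?R" using closed by blast+
    moreover have "b * a = 1" using b by (simp add: mult.commute)
    ultimately show ?thesis using b[symmetric]
      unfolding Units_def by (auto simp: poly_ring_def subring_on_def)
  qed
  have units': "a dvd 1" if "a \<in> Units ?R" for a
  proof -
    obtain b where "a * b = 1" using \<open>a \<in> Units ?R\<close> by (auto simp: Units_def poly_ring_def subring_on_def)
    then show ?thesis by (metis dvd_triv_left)
  qed
  have "a dvd 1 \<or> b dvd 1" if ab: "p = a * b" for a b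
  proof (cases "p divides\<^bsub>?R\<^esub> a")
    case True
    then obtain c where c: "a = p * c" by (auto simp: factor_def poly_ring_def subring_on_def)
    have "p * 1 = p * (b * c)" using ab unfolding c by (simp add: mult_ac)
    then have "1 = b * c" using p0 mult_left_cancel[of p 1 "b * c"] by blast
    then have "b dvd 1" by (rule dvdI)
    then show ?thesis ..
  next
    case False
    have ca: "a \<in> carrier ?R" "b \<in> carrier ?R" using closed[of a b] p(1) p0 unfolding ab by blast+
    have "p = a \<otimes>\<^bsub>?R\<^esub> b" using ab by (simp add: poly_ring_def subring_on_def)
    then have "a divides\<^bsub>?R\<^esub> p" using ca(2) unfolding factor_def by blast
    then have "a \<in> Units ?R" using irr[OF ca(1)] False by (simp add: properfactor_def)
    then show ?thesis using units' by blast
  qed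
  then show ?thesis using p0 nu units unfolding Factorial_Ring.irreducible_def by blast
qed

section \<open>Primes of height one\<close>

lemma dvd_poly_ring:
  fixes p :: "('v::linorder, 'a::field) mpoly"
  assumes "p dvd a" "mvars a \<subseteq> V" "a \<noteq> 0"
  obtains b where "a = p * b" "mvars b \<subseteq> V"
proof -
  obtain b where b: "a = p * b" using assms(1) by (rule dvdE)
  then have "mvars b \<subseteq> V" using assms mvars_mult_eq[of p b] by auto
  then show ?thesis using that b by blast
qed

lemma codimension_one_dvd:
  fixes p :: "('v::linorder, 'a::field) mpoly"
  assumes irr: "Factorial_Ring.irreducible p"
    and codim: "codimension (poly_ring V) I = 1"
    and "p \<in> I" "f \<in> I"
  shows "p dvd f"
proof -
  let ?R = "poly_ring V :: ('v, 'a) mpoly ring"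
  let ?S = "{q :: ('v, 'a) mpoly. mvars q \<subseteq> V}"
  interpret subring_set ?S by (rule subring_set_mvars)
  have R: "?R = subring_on ?S" by (simp add: poly_ring_def)
  have cr: "cring ?R" unfolding R by (rule cring_subring_on)
  \<comment> \<open>The infimum defining the codimension is attained: \<open>enat\<close> is
    well-ordered, and the set is nonempty because the empty infimum is infinite.\<close>
  obtain P where P: "primeideal P ?R" "I \<subseteq> P" "prime_height ?R P = 1"
  proof -
    let ?A = "prime_height ?R ` {P. primeideal P ?R \<and> I \<subseteq> P}"
    have Inf: "Inf ?A = 1" using codim unfolding codimension_def .
    then have ne: "?A \<noteq> {}" by (metis Inf_empty top_enat_def infinity_ne_i1)
    then obtain h where h: "h \<in> ?A" by blast
    have "Inf ?A \<in> ?A" unfolding Inf_enat_def if_not_P[OF ne] using h by (rule LeastI)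
    then have "1 \<in> ?A" unfolding Inf .
    then show thesis using that by auto
  qed
  have IP: "ideal P (subring_on ?S)" using P(1) unfolding R by (rule primeideal.axioms)
  note PD = ideal_subring_onD[OF IP]
  have p: "mvars p \<subseteq> V" "p \<in> P" using PD(1) P(2) \<open>p \<in> I\<close> by auto
  have p0: "p \<noteq> 0" and p1: "\<not> p dvd 1" using irr by (auto simp: Factorial_Ring.irreducible_def)
  have pr: "prime_elem p" using irr by (rule irreducible_imp_prime_elem_mpoly)
  \<comment> \<open>Divisibility is that of the full ring; by \<open>dvd_poly_ring\<close>,
    \<open>Z\<close> is nevertheless the principal ideal of \<open>p\<close> in
    \<open>?R\<close>.\<close>
  define Z where "Z = {q \<in> ?S. p dvd q}"
  have "primeideal {0} ?R"
  proof (rule primeidealI[OF _ cr])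
    show "ideal {0} ?R" unfolding R by (rule ideal_subring_onI) (auto simp: zero)
    have "1 \<in> carrier ?R" using one by (simp add: carrier_poly_ring)
    then show "carrier ?R \<noteq> {0}" by (metis singletonD zero_neq_one)
  qed (auto simp: poly_ring_def subring_on_def)
  moreover have "primeideal Z ?R"
  proof (rule primeidealI[OF _ cr])
    show "ideal Z ?R" unfolding R Z_def
      by (rule ideal_subring_onI) (use add mult zero in auto)
    show "carrier ?R \<noteq> Z" using one p1 by (auto simp: Z_def carrier_poly_ring)
  qed (use prime_elem_dvd_mult_iff[OF pr] in \<open>auto simp: Z_def poly_ring_def subring_on_def\<close>)
  moreover have "{0} \<subset> Z" using p p0 zero by (auto simp: Z_def)
  moreover have "Z \<subseteq> P"
  proof
    fix q assume q: "q \<in> Z"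
    show "q \<in> P"
    proof (cases "q = 0")
      case False
      then obtain b where "q = p * b" "mvars b \<subseteq> V"
        using dvd_poly_ring[of p q V] q by (auto simp: Z_def)
      then show ?thesis using PD(5)[OF p(2), of b] by simp
    qed (simp add: PD(2))
  qed
  moreover have "\<not> Z \<subset> P"
  proof
    assume "Z \<subset> P"
    \<comment> \<open>Otherwise \<open>{0}\<close>, \<open>Z\<close>, \<open>P\<close> is a chain of
      length 2 ending in a prime of height 1.\<close>
    with calculation P(1) have "enat (length [{0}, Z, P] - 1) \<le> prime_height ?R P"
      unfolding prime_height_def by (intro SUP_upper) auto
    then show False using P(3) by (simp add: one_enat_def)
  qed
  ultimately have "P = Z" by blast
  then show ?thesis using \<open>f \<in> I\<close> P(2) by (auto simp: Z_def)
qed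

text \<open>A linear order on the variables makes the library's instance of \<open>idom\<close> for polynomials
  applicable; which order is chosen does not matter.\<close>

instance aind :: countable
  by countable_datatype

instance der :: (countable) countable
  by countable_datatype

instantiation der :: (countable) linorder
begin

definition less_eq_der :: "'a der \<Rightarrow> 'a der \<Rightarrow> bool" where
  "less_eq_der x y \<longleftrightarrow> to_nat x \<le> to_nat y"

definition less_der :: "'a der \<Rightarrow> 'a der \<Rightarrow> bool" where
  "less_der x y \<longleftrightarrow> to_nat x < to_nat y"

instance
  by standard (auto simp: less_eq_der_def less_der_def)

end

section \<open>Derivations and the substitution of zeta\<close>

definition derivation :: "('a::comm_ring_1 \<Rightarrow> 'a) \<Rightarrow> bool" where
  "derivation d \<longleftrightarrow> (\<forall>a b. d (a + b) = d a + d b) \<and> (\<forall>a b. d (a * b) = d a * b + a * d b)"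

lemma derivationD:
  assumes "derivation d"
  shows "d (a + b) = d a + d b" "d (a * b) = d a * b + a * d b" "d 0 = 0" "d 1 = 0"
    "d (- a) = - d a" "d (a - b) = d a - d b"
proof -
  have add: "d (a + b) = d a + d b" and mult: "d (a * b) = d a * b + a * d b" for a b
    using assms by (auto simp: derivation_def)
  show "d (a + b) = d a + d b" "d (a * b) = d a * b + a * d b" by (fact add mult)+
  show z: "d 0 = 0" using add[of 0 0] by simp
  show "d 1 = 0" using mult[of 1 1] by simp
  show u: "d (- a) = - d a" for a using add[of a "- a"] z by (simp add: eq_neg_iff_add_eq_0 add.commute)
  show "d (a - b) = d a - d b" using add[of a "- b"] u by simp
qed

text \<open>Leibniz's rule is additive in each factor, so products of single terms suffice.\<close>

lemma derivationI:
  fixes d :: "('e::comm_monoid_add \<Rightarrow>\<^sub>0 'a::comm_ring_1) \<Rightarrow> ('e \<Rightarrow>\<^sub>0 'a)"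
  assumes add: "\<And>p q. d (p + q) = d p + d q"
    and mult: "\<And>m c m' c'. d (Poly_Mapping.single m c * Poly_Mapping.single m' c') =
      d (Poly_Mapping.single m c) * Poly_Mapping.single m' c' + Poly_Mapping.single m c * d (Poly_Mapping.single m' c')"
  shows "derivation d"
proof -
  have d0: "d 0 = 0" using add[of 0 0] by simp
  have "d (p * q) = d p * q + p * d q" for p q
  proof (induction p rule: poly_mapping_additive_induct)
    case (single m c)
    show ?case
      by (induction q rule: poly_mapping_additive_induct) (simp_all add: add mult d0 algebra_simps)
  qed (simp_all add: add d0 algebra_simps)
  then show ?thesis using add by (simp add: derivation_def)
qed

section \<open>The derivations on polynomials and Laurent polynomials\<close>

lemma dp_deriv_0 [simp]: "dp_deriv 0 = 0"
  by (simp add: dp_deriv_def)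

lemma dp_deriv_single:
  "dp_deriv (Poly_Mapping.single m c) = (\<Sum>v\<in>Poly_Mapping.keys m.
     Poly_Mapping.single (m - Poly_Mapping.single v 1 + Poly_Mapping.single (shift v) 1)
       (of_nat (Poly_Mapping.lookup m v) * c))"
  by (cases "c = 0") (simp_all add: dp_deriv_def)

lemma dp_deriv_add: "dp_deriv (p + q) = dp_deriv p + dp_deriv q"
  unfolding dp_deriv_def
  by (rule setsum_keys_plus_distrib) (simp_all add: distrib_left single_add sum.distrib)

lemma derivation_dp_deriv: "derivation (dp_deriv :: ('x der, 'a::comm_ring_1) mpoly \<Rightarrow> _)"
proof (rule derivationI)
  fix m m' :: "'x der \<Rightarrow>\<^sub>0 nat" and c c' :: 'a
  let ?K = "Poly_Mapping.keys m \<union> Poly_Mapping.keys m'"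
  let ?s = "\<lambda>k v. k - Poly_Mapping.single v 1 + Poly_Mapping.single (shift v) (1::nat)"
  have single: "dp_deriv (Poly_Mapping.single k a) =
      (\<Sum>v\<in>?K. Poly_Mapping.single (?s k v) (of_nat (Poly_Mapping.lookup k v) * a))"
    if "Poly_Mapping.keys k \<subseteq> ?K" for k and a :: 'a
    unfolding dp_deriv_single using that by (intro sum.mono_neutral_left) (auto simp: in_keys_iff)
  \<comment> \<open>Subtraction of natural exponents is truncated, so the two exponents may differ
    when \<open>v\<close> is absent from \<open>a\<close>; but then the coefficient
    vanishes.\<close>
  have shift_left: "Poly_Mapping.single (?s (a + b) v) (of_nat (Poly_Mapping.lookup a v) * x) =
      Poly_Mapping.single (?s a v + b) (of_nat (Poly_Mapping.lookup a v) * x)"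
    for a b :: "'x der \<Rightarrow>\<^sub>0 nat" and v and x :: 'a
  proof (cases "Poly_Mapping.lookup a v = 0")
    case False
    then have "?s (a + b) v = ?s a v + b"
      by (intro poly_mapping_eqI) (auto simp: lookup_add lookup_minus lookup_single when_def)
    then show ?thesis by simp
  qed simp
  have "dp_deriv (Poly_Mapping.single m c * Poly_Mapping.single m' c') =
      (\<Sum>v\<in>?K. Poly_Mapping.single (?s (m + m') v) (of_nat (Poly_Mapping.lookup m v) * (c * c')) +
        Poly_Mapping.single (?s (m' + m) v) (of_nat (Poly_Mapping.lookup m' v) * (c * c')))"
    unfolding mult_single
    by (subst single[OF keys_add]) (simp add: lookup_add algebra_simps single_add[symmetric])
  also have "\<dots> = (\<Sum>v\<in>?K. Poly_Mapping.single (?s m v + m') (of_nat (Poly_Mapping.lookup m v) * (c * c'))) +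
      (\<Sum>v\<in>?K. Poly_Mapping.single (?s m' v + m) (of_nat (Poly_Mapping.lookup m' v) * (c * c')))"
    by (simp only: shift_left sum.distrib)
  also have "\<dots> = dp_deriv (Poly_Mapping.single m c) * Poly_Mapping.single m' c' +
      Poly_Mapping.single m c * dp_deriv (Poly_Mapping.single m' c')"
    by (simp add: single sum_distrib_left sum_distrib_right mult_single mult_ac add_ac)
  finally show "dp_deriv (Poly_Mapping.single m c * Poly_Mapping.single m' c') = \<dots>" .
qed (rule dp_deriv_add)

lemma dp_deriv_mconst [simp]: "dp_deriv (mconst c) = 0"
  by (simp add: mconst_def dp_deriv_single)

lemma dp_deriv_mvar: "dp_deriv (mvar v :: ('x der, 'a::comm_ring_1) mpoly) = mvar (shift v)"
  by (simp add: mvar_def dp_deriv_single)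

lemma dl_deriv_single:
  assumes "d 0 = 0"
  shows "dl_deriv d (Poly_Mapping.single m c) = Poly_Mapping.single m (d c) +
    (\<Sum>v\<in>Poly_Mapping.keys m.
     Poly_Mapping.single (m - Poly_Mapping.single v 1 + Poly_Mapping.single (shift v) 1)
       (of_int (Poly_Mapping.lookup m v) * c))"
  using assms by (cases "c = 0") (simp_all add: dl_deriv_def)

lemma derivation_dl_deriv:
  fixes d :: "'a::comm_ring_1 \<Rightarrow> 'a"
  assumes d: "derivation d"
  shows "derivation (dl_deriv d :: ('x der, 'a) laurent \<Rightarrow> _)"
proof (rule derivationI)
  note d0 = derivationD(3)[OF d]
  show "dl_deriv d (p + q) = dl_deriv d p + dl_deriv d q" for p q :: "('x der, 'a) laurent"
    unfolding dl_deriv_def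
    by (rule setsum_keys_plus_distrib)
      (simp_all add: derivationD[OF d] distrib_left single_add sum.distrib)
  fix m m' :: "'x der \<Rightarrow>\<^sub>0 int" and c c' :: 'a
  let ?K = "Poly_Mapping.keys m \<union> Poly_Mapping.keys m'"
  let ?s = "\<lambda>k v. k - Poly_Mapping.single v 1 + Poly_Mapping.single (shift v) (1::int)"
  have single: "dl_deriv d (Poly_Mapping.single k a) = Poly_Mapping.single k (d a) +
      (\<Sum>v\<in>?K. Poly_Mapping.single (?s k v) (of_int (Poly_Mapping.lookup k v) * a))"
    if "Poly_Mapping.keys k \<subseteq> ?K" for k and a :: 'a
    unfolding dl_deriv_single[of d, OF d0] using that
    by (intro arg_cong2[where f = "(+)"] refl sum.mono_neutral_left) (auto simp: in_keys_iff)
  have "dl_deriv d (Poly_Mapping.single m c * Poly_Mapping.single m' c') =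
      Poly_Mapping.single (m + m') (d (c * c')) +
      (\<Sum>v\<in>?K. Poly_Mapping.single (?s m v + m') (of_int (Poly_Mapping.lookup m v) * (c * c')) +
        Poly_Mapping.single (?s m' v + m) (of_int (Poly_Mapping.lookup m' v) * (c * c')))"
    unfolding mult_single
    by (subst single[OF keys_add]) (simp add: lookup_add algebra_simps single_add[symmetric])
  also have "\<dots> = dl_deriv d (Poly_Mapping.single m c) * Poly_Mapping.single m' c' +
      Poly_Mapping.single m c * dl_deriv d (Poly_Mapping.single m' c')"
    by (simp add: single derivationD(2)[OF d] single_add distrib_left distrib_right
        sum.distrib sum_distrib_left sum_distrib_right mult_single mult_ac add_ac)
  finally show "dl_deriv d (Poly_Mapping.single m c * Poly_Mapping.single m' c') = \<dots>" .
qed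

lemma derivation_ld_deriv: "derivation ld_deriv"
  by (rule derivation_dl_deriv[OF derivation_dp_deriv])

lemma ld_deriv_single:
  "ld_deriv (Poly_Mapping.single m c) = Poly_Mapping.single m (dp_deriv c) +
    (\<Sum>v\<in>Poly_Mapping.keys m.
     Poly_Mapping.single (m - Poly_Mapping.single v 1 + Poly_Mapping.single (shift v) 1)
       (of_int (Poly_Mapping.lookup m v) * c))"
  by (rule dl_deriv_single) simp

lemma ld_deriv_mconst: "ld_deriv (mconst p) = mconst (dp_deriv p)"
  by (simp add: mconst_def ld_deriv_single)

lemma funpow_ld_deriv_add:
  "(ld_deriv ^^ m) (f + g) = (ld_deriv ^^ m) f + (ld_deriv ^^ m) g"
  by (induction m) (simp_all add: derivationD[OF derivation_ld_deriv])

lemma funpow_ld_deriv_diff: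
  "(ld_deriv ^^ m) (f - g) = (ld_deriv ^^ m) f - (ld_deriv ^^ m) g"
  by (induction m) (simp_all add: derivationD[OF derivation_ld_deriv])

lemma funpow_ld_deriv_mconst_mvar:
  "(ld_deriv ^^ m) (mconst (mvar (Der a k))) = mconst (mvar (Der a (k + m)))"
  by (induction m) (simp_all add: ld_deriv_mconst dp_deriv_mvar)

section \<open>The substitution of zeta as a differential homomorphism\<close>

definition zeta_var :: "(nat \<Rightarrow> nat) \<Rightarrow> (nat \<Rightarrow> nat \<Rightarrow> umonom) \<Rightarrow> aind der \<Rightarrow> ldpoly" where
  "zeta_var l M v = (case v of Der a m \<Rightarrow> (case a of AI i k \<Rightarrow>
        if k = 0 then (ld_deriv ^^ m) (zeta l M i) else mconst (mvar v)))"

lemma eval_zeta_eq_meval: "eval_zeta l M = meval (\<lambda>c. mconst (mconst c)) (zeta_var l M)"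
  by (rule ext) (simp add: eval_zeta_def zeta_var_def[abs_def])

lemma ring_hom_eval_zeta: "ring_hom_fun (eval_zeta l M)"
  unfolding eval_zeta_eq_meval
  by (intro ring_hom_meval ring_hom_fun_comp[OF ring_hom_mconst ring_hom_mconst])

lemmas eval_zeta_simps = ring_hom_funD[OF ring_hom_eval_zeta]

lemma eval_zeta_mconst: "eval_zeta l M (mconst c) = mconst (mconst c)"
  unfolding eval_zeta_eq_meval by (rule meval_mconst) simp

lemma eval_zeta_mvar: "eval_zeta l M (mvar v) = zeta_var l M v"
  unfolding eval_zeta_eq_meval by (rule meval_mvar) simp_all

lemma zeta_var_shift: "zeta_var l M (shift v) = ld_deriv (zeta_var l M v)"
  by (cases v) (auto simp: zeta_var_def ld_deriv_mconst dp_deriv_mvar split: aind.splits)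

text \<open>The values substituted for successive derivatives are themselves successive derivatives,
  by \<open>zeta_var_shift\<close>. Leibniz's rule carries this from variables to sums and
  products.\<close>

lemma eval_zeta_dp_deriv: "eval_zeta l M (dp_deriv p) = ld_deriv (eval_zeta l M p)"
proof -
  let ?S = "{p. eval_zeta l M (dp_deriv p) = ld_deriv (eval_zeta l M p)}"
  note d = derivationD[OF derivation_dp_deriv] derivationD[OF derivation_ld_deriv] eval_zeta_simps
  have "meval mconst mvar p \<in> ?S"
  proof (rule meval_closed)
    show "mconst c \<in> ?S" for c by (simp add: eval_zeta_mconst ld_deriv_mconst d)
    show "mvar v \<in> ?S" for v by (simp add: dp_deriv_mvar eval_zeta_mvar zeta_var_shift)
  qed (simp_all add: d)
  then show ?thesis by (simp add: meval_id)
qed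

text \<open>The extension of \<open>eval_zeta\<close> that fixes the monomials in the
  \<open>u\<close>. It is a differential ring endomorphism killing the system, so its kernel
  contains the differential ideal of the system.\<close>

definition eval_zeta_laurent :: "(nat \<Rightarrow> nat) \<Rightarrow> (nat \<Rightarrow> nat \<Rightarrow> umonom) \<Rightarrow> ldpoly \<Rightarrow> ldpoly" where
  "eval_zeta_laurent l M f =
     (\<Sum>m\<in>Poly_Mapping.keys f. Poly_Mapping.single m 1 * eval_zeta l M (Poly_Mapping.lookup f m))"

lemma eval_zeta_laurent_single:
  "eval_zeta_laurent l M (Poly_Mapping.single m p) = Poly_Mapping.single m 1 * eval_zeta l M p"
  by (cases "p = 0") (simp_all add: eval_zeta_laurent_def eval_zeta_simps)

lemma eval_zeta_laurent_add:
  "eval_zeta_laurent l M (f + g) = eval_zeta_laurent l M f + eval_zeta_laurent l M g"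
  unfolding eval_zeta_laurent_def
  by (rule setsum_keys_plus_distrib) (simp_all add: eval_zeta_simps distrib_left)

lemma eval_zeta_laurent_0 [simp]: "eval_zeta_laurent l M 0 = 0"
  by (simp add: eval_zeta_laurent_def)

lemma eval_zeta_laurent_sum:
  "eval_zeta_laurent l M (sum f X) = (\<Sum>x\<in>X. eval_zeta_laurent l M (f x))"
  by (induction X rule: infinite_finite_induct) (simp_all add: eval_zeta_laurent_add)

lemma eval_zeta_laurent_mult:
  "eval_zeta_laurent l M (f * g) = eval_zeta_laurent l M f * eval_zeta_laurent l M g"
proof (induction f rule: poly_mapping_additive_induct)
  case (single m c)
  show ?case
  proof (induction g rule: poly_mapping_additive_induct)
    case (single m' c')
    have *: "Poly_Mapping.single (m + m') (1::dpoly) = Poly_Mapping.single m 1 * Poly_Mapping.single m' 1"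
      by (simp add: mult_single)
    show ?case
      unfolding mult_single[of m c] eval_zeta_laurent_single eval_zeta_simps(4) * by (simp only: mult_ac)
  qed (simp_all add: eval_zeta_laurent_add distrib_left)
qed (simp_all add: eval_zeta_laurent_add distrib_right)

lemma eval_zeta_laurent_mconst: "eval_zeta_laurent l M (mconst p) = eval_zeta l M p"
  by (simp add: mconst_def eval_zeta_laurent_single)

lemma eval_zeta_of_int: "eval_zeta l M (of_int k) = of_int k"
  using eval_zeta_mconst[of l M "of_int k"] by (simp add: mconst_def)

text \<open>On a single term, differentiating the coefficient is covered by
  \<open>eval_zeta_dp_deriv\<close>, and differentiating the monomial produces integer coefficients,
  which the substitution fixes.\<close>

lemma eval_zeta_laurent_ld_deriv:
  "eval_zeta_laurent l M (ld_deriv f) = ld_deriv (eval_zeta_laurent l M f)"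
proof (induction f rule: poly_mapping_additive_induct)
  case (single m p)
  let ?s = "\<lambda>v. m - Poly_Mapping.single v 1 + Poly_Mapping.single (shift v) 1"
  have D: "ld_deriv (Poly_Mapping.single m 1) =
      (\<Sum>v\<in>Poly_Mapping.keys m. Poly_Mapping.single (?s v) (of_int (Poly_Mapping.lookup m v)))"
    by (simp add: ld_deriv_single derivationD[OF derivation_dp_deriv])
  have "eval_zeta_laurent l M (ld_deriv (Poly_Mapping.single m p)) =
      Poly_Mapping.single m 1 * ld_deriv (eval_zeta l M p) +
      (\<Sum>v\<in>Poly_Mapping.keys m. Poly_Mapping.single (?s v) 1 *
        (of_int (Poly_Mapping.lookup m v) * eval_zeta l M p))"
    by (simp add: ld_deriv_single eval_zeta_laurent_add eval_zeta_laurent_sum eval_zeta_laurent_single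
        eval_zeta_dp_deriv eval_zeta_simps eval_zeta_of_int)
  also have "(\<Sum>v\<in>Poly_Mapping.keys m. Poly_Mapping.single (?s v) 1 *
        (of_int (Poly_Mapping.lookup m v) * eval_zeta l M p)) =
      ld_deriv (Poly_Mapping.single m 1) * eval_zeta l M p"
    unfolding D sum_distrib_right mult.assoc[symmetric]
    by (intro sum.cong refl arg_cong2[where f = "(*)"])
      (simp add: mult_single flip: single_of_int)
  finally show ?case
    by (simp add: eval_zeta_laurent_single derivationD(2)[OF derivation_ld_deriv])
qed (simp_all add: eval_zeta_laurent_add derivationD[OF derivation_ld_deriv])

section \<open>Ideals containing the system\<close>

definition laurent_set :: "'a::comm_ring_1 set \<Rightarrow> 'v set \<Rightarrow> ('v, 'a) laurent set" where
  "laurent_set B V = {f. mvars f \<subseteq> V \<and> (\<forall>m. Poly_Mapping.lookup f m \<in> B)}"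

lemma laurent_ring_eq: "laurent_ring B V = subring_on (laurent_set B V)"
  by (simp add: laurent_ring_def laurent_set_def)

lemma laurent_set_single:
  "0 \<in> B \<Longrightarrow> c \<in> B \<Longrightarrow> Poly_Mapping.keys m \<subseteq> V \<Longrightarrow> Poly_Mapping.single m c \<in> laurent_set B V"
  by (auto simp: laurent_set_def mvars_def lookup_single when_def split: if_splits)

lemma laurent_set_mono: "B \<subseteq> B' \<Longrightarrow> V \<subseteq> V' \<Longrightarrow> laurent_set B V \<subseteq> laurent_set B' V'"
  by (auto simp: laurent_set_def)

lemma subring_set_laurent_set:
  assumes "subring_set B"
  shows "subring_set (laurent_set B V)"
proof -
  interpret B: subring_set B by fact
  show ?thesis
  proof
    show "1 \<in> laurent_set B V"
      using laurent_set_single[OF B.zero B.one, of 0 V] by simp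
    show "- a \<in> laurent_set B V" if "a \<in> laurent_set B V" for a
      using that by (simp add: laurent_set_def B.uminus)
    show "a + b \<in> laurent_set B V" if "a \<in> laurent_set B V" "b \<in> laurent_set B V" for a b
      using that mvars_add[of a b] by (auto simp: laurent_set_def B.add lookup_add)
    show "a * b \<in> laurent_set B V" if "a \<in> laurent_set B V" "b \<in> laurent_set B V" for a b
    proof -
      have "Poly_Mapping.lookup (a * b) m \<in> B" for m
        unfolding lookup_mult Sum_any.expand_set
        by (intro sum_closed B.zero B.add B.mult)
          (use that in \<open>auto simp: laurent_set_def when_def B.zero\<close>)
      then show ?thesis using that mvars_mult[of a b] by (auto simp: laurent_set_def)
    qed
  qed
qed

lemma (in subring_set) of_nat: "of_nat n \<in> S"
  by (induction n) (simp_all add: zero one add)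

lemma (in subring_set) of_int: "of_int k \<in> S"
  by (cases k rule: int_cases2) (simp_all add: of_nat uminus)

lemma ld_deriv_laurent_set:
  assumes B: "subring_set B" "dp_deriv ` B \<subseteq> B" and V: "V \<subseteq> W" "shift ` V \<subseteq> W"
    and f: "f \<in> laurent_set B V"
  shows "ld_deriv f \<in> laurent_set B W"
proof -
  interpret B: subring_set B by (rule B)
  interpret L: subring_set "laurent_set B W" by (rule subring_set_laurent_set[OF B(1)])
  have keys: "Poly_Mapping.keys (m - Poly_Mapping.single v 1 + Poly_Mapping.single (shift v) 1) \<subseteq> W"
    if "m \<in> Poly_Mapping.keys f" "v \<in> Poly_Mapping.keys m" for m v
  proof -
    have "Poly_Mapping.keys m \<subseteq> V" using f that by (auto simp: laurent_set_def mvars_def)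
    moreover have "Poly_Mapping.keys (m - Poly_Mapping.single v 1 + Poly_Mapping.single (shift v) 1) \<subseteq>
        Poly_Mapping.keys m \<union> {v, shift v}"
      by (auto simp: in_keys_iff lookup_add lookup_minus lookup_single when_def split: if_splits)
    ultimately show ?thesis using that V by blast
  qed
  show ?thesis
    unfolding dl_deriv_def
    by (intro sum_closed L.zero L.add laurent_set_single B.zero B.mult B.of_int keys)
      (use f B V in \<open>auto simp: laurent_set_def mvars_def\<close>)
qed

text \<open>\<open>C t\<close> plays the role of the coefficients in which the order has been raised by at most \<open>t\<close>:
  Leibniz's rule trades one outer derivation for one on either factor.\<close>

lemma derivative_mult_in_ideal:
  assumes I: "ideal I (subring_on S)" and F: "\<And>k. k \<le> N \<Longrightarrow> (ld_deriv ^^ k) F \<in> I"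
    and CS: "C N \<subseteq> S" and C: "\<And>t g. g \<in> C t \<Longrightarrow> g \<in> C (Suc t) \<and> ld_deriv g \<in> C (Suc t)"
    and g: "g \<in> C t" "t + m \<le> N" "e + m \<le> N"
  shows "(ld_deriv ^^ m) (g * (ld_deriv ^^ e) F) \<in> I"
  using g
proof (induction m arbitrary: g t e)
  case 0
  have "C t \<subseteq> C N"
  proof (rule lift_Suc_mono_le)
    show "C t \<subseteq> C (Suc t)" for t using C by blast
    show "t \<le> N" using 0 by simp
  qed
  then have "g \<in> S" using 0 CS by blast
  moreover have "(ld_deriv ^^ e) F \<in> I" using 0 by (intro F) simp
  ultimately show ?case using ideal_subring_onD(4)[OF I] by simp
next
  case (Suc m)
  have "(ld_deriv ^^ m) (ld_deriv g * (ld_deriv ^^ e) F) \<in> I"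
    using Suc.IH[of "ld_deriv g" "Suc t" e] C[OF Suc.prems(1)] Suc.prems by simp
  moreover have "(ld_deriv ^^ m) (g * (ld_deriv ^^ Suc e) F) \<in> I"
    using Suc.IH[of g "Suc t" "Suc e"] C[OF Suc.prems(1)] Suc.prems by simp
  ultimately show ?case
    using ideal_subring_onD(3)[OF I]
    by (simp add: funpow_swap1 derivationD(2)[OF derivation_ld_deriv] funpow_ld_deriv_add)
qed

text \<open>The monomials of one polynomial are distinct, so \<open>M i k\<close> keeps its own
  indeterminate as coefficient and nothing cancels.\<close>

lemma keys_subset_mvars_FF:
  assumes "generic_system n l M" "i \<in> {1..n}" "k \<le> l i"
  shows "Poly_Mapping.keys (M i k) \<subseteq> mvars (FF l M i)"
proof -
  have inj: "inj_on (M i) {..l i}" using assms by (auto simp: generic_system_def)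
  have "Poly_Mapping.lookup (FF l M i) (M i k) =
      (\<Sum>k'\<le>l i. if k' = k then mvar (Der (AI i k') 0) else 0)"
    unfolding FF_def lookup_sum
  proof (rule sum.cong)
    fix k' assume "k' \<in> {..l i}"
    then have "M i k' = M i k \<longleftrightarrow> k' = k" using inj_on_eq_iff[OF inj, of k' k] assms(3) by simp
    then show "Poly_Mapping.lookup (Poly_Mapping.single (M i k') (mvar (Der (AI i k') 0))) (M i k) =
        (if k' = k then mvar (Der (AI i k') 0) else 0)"
      by (simp add: lookup_single when_def)
  qed simp
  also have "\<dots> = mvar (Der (AI i k) 0)" using assms(3) by simp
  finally have "M i k \<in> Poly_Mapping.keys (FF l M i)"
    by (simp add: in_keys_iff mvar_def) (metis lookup_single_eq lookup_zero zero_neq_one)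
  then show ?thesis by (auto simp: mvars_def)
qed

lemma finite_occ_orders [simp]: "finite (occ_orders j f)"
proof -
  have "occ_orders j f = Der j -` mvars f" by (auto simp: occ_orders_def)
  then show ?thesis by (simp add: finite_vimageI inj_def)
qed

lemma monomial_inverse_FF:
  "Poly_Mapping.single (- M i 0) 1 * FF l M i = mconst (mvar (Der (AI i 0) 0)) - zeta l M i"
proof -
  have "{..l i} = insert 0 {1..l i}" by auto
  then show ?thesis
    unfolding FF_def zeta_def mconst_def sum_distrib_left
    by (simp add: mult_single)
qed

lemma subring_set_constants: "subring_set (range (mconst :: rat \<Rightarrow> dpoly))"
proof -
  have "range (mconst :: rat \<Rightarrow> dpoly) = {p. mvars p \<subseteq> {}}" by (auto simp: mvars_empty_iff)
  then show ?thesis using subring_set_mvars[of "{}"] by simp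
qed

text \<open>Differentiate \<open>monomial_inverse_FF\<close> \<open>m\<close> times. The point is
  that the derivatives of the inverse monomial needed as cofactors involve only variables of
  \<open>V_tau n l M \<tau>\<close>, so the membership holds in the ideal with bounded
  orders.\<close>

lemma leading_variable_congruent:
  assumes gs: "generic_system n l M" and i: "i \<in> {1..n}" and m: "ereal (real m) \<le> \<tau> i"
    and B: "subring_set B" "range mconst \<subseteq> B" and V: "V_tau n l M \<tau> \<subseteq> V"
    and I: "ideal I (laurent_ring B V)" and PS: "PS n l M \<tau> \<subseteq> I"
  shows "mconst (mvar (Der (AI i 0) m)) - (ld_deriv ^^ m) (zeta l M i) \<in> I"
proof -
  \<comment> \<open>\<open>W t\<close> contains the variables that up to \<open>t\<close>
    derivations of the inverse of \<open>M i 0\<close> can produce: an order \<open>k0\<close>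
    present there rises by at most \<open>t\<close>.\<close>
  define W where "W t = {Der j k | j k. \<exists>k0. Der j k0 \<in> Poly_Mapping.keys (M i 0) \<and> k0 \<le> k \<and> k \<le> k0 + t}" for t
  \<comment> \<open>The inverse monomial has coefficient 1, so rational coefficients suffice and
    \<open>B\<close> need not be closed under derivation.\<close>
  define C where "C t = laurent_set (range mconst :: dpoly set) (W t)" for t
  have W: "W t \<subseteq> W (Suc t)" "shift ` W t \<subseteq> W (Suc t)" for t
    unfolding W_def by (fastforce intro: le_SucI)+
  have "W m \<subseteq> V"
    unfolding W_def
  proof (safe, rule V[THEN subsetD])
    fix j k k0 assume *: "Der j k0 \<in> Poly_Mapping.keys (M i 0)" "k0 \<le> k" "k \<le> k0 + m"
    have j: "j \<in> {1..n-1}" using gs i *(1) by (fastforce simp: generic_system_def ders_def)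
    have occ: "k0 \<in> occ_orders j (FF l M i)"
      using keys_subset_mvars_FF[OF gs i, of 0] *(1) by (auto simp: occ_orders_def)
    have "gam n l M j \<le> k0" unfolding gam_def using occ i by (intro Min_le) auto
    \<comment> \<open>The order \<open>k0\<close> occurs in \<open>FF l M i\<close>,
      \<open>k\<close> exceeds it by at most \<open>m\<close>, and \<open>m\<close> is at most
      \<open>\<tau> i\<close>; so the term for \<open>i\<close> in the supremum already bounds
      \<open>k\<close>.\<close>
    moreover have "ereal (real k) \<le> (SUP i\<in>{1..n}. ord_u l M i j + \<tau> i)"
    proof (rule SUP_upper2[OF i])
      have "ereal (real k) \<le> ereal (real k0) + ereal (real m)" using *(3) by simp
      also have "\<dots> \<le> ord_u l M i j + \<tau> i"
        unfolding ord_u_def by (intro add_mono SUP_upper occ m)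
      finally show "ereal (real k) \<le> ord_u l M i j + \<tau> i" .
    qed
    ultimately show "Der j k \<in> V_tau n l M \<tau>" using j *(2) by (auto simp: V_tau_def)
  qed
  then have CS: "C m \<subseteq> laurent_set B V"
    unfolding C_def by (intro laurent_set_mono B)
  have C: "g \<in> C (Suc t) \<and> ld_deriv g \<in> C (Suc t)" if "g \<in> C t" for t g
  proof
    show "g \<in> C (Suc t)" using that laurent_set_mono[OF subset_refl W(1)] unfolding C_def by blast
    have "dp_deriv ` range mconst \<subseteq> (range mconst :: dpoly set)"
      by (auto intro: range_eqI[of _ _ 0])
    then show "ld_deriv g \<in> C (Suc t)"
      using that unfolding C_def by (intro ld_deriv_laurent_set[OF subring_set_constants _ W])
  qed
  have F: "(ld_deriv ^^ k) (FF l M i) \<in> I" if "k \<le> m" for k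
  proof -
    have "ereal (real k) \<le> \<tau> i" using that m by (meson ereal_less_eq(3) of_nat_mono order_trans)
    then show ?thesis using PS i by (auto simp: PS_def)
  qed
  have "Poly_Mapping.single (- M i 0) 1 \<in> C 0"
    unfolding C_def
  proof (rule laurent_set_single)
    show "0 \<in> range (mconst :: rat \<Rightarrow> dpoly)" by (rule range_eqI[of _ _ 0]) simp
    show "1 \<in> range (mconst :: rat \<Rightarrow> dpoly)" by (rule range_eqI[of _ _ 1]) simp
    show "Poly_Mapping.keys (- M i 0) \<subseteq> W 0"
    proof
      fix v assume "v \<in> Poly_Mapping.keys (- M i 0)"
      then show "v \<in> W 0" by (cases v) (auto simp: W_def)
    qed
  qed
  then have "(ld_deriv ^^ m) (Poly_Mapping.single (- M i 0) 1 * (ld_deriv ^^ 0) (FF l M i)) \<in> I"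
    by (intro derivative_mult_in_ideal[OF I[unfolded laurent_ring_eq] F CS C, where t = 0]) auto
  then show ?thesis
    by (simp add: monomial_inverse_FF funpow_ld_deriv_diff funpow_ld_deriv_mconst_mvar)
qed

text \<open>The polynomials congruent modulo \<open>I\<close> to their value at zeta form a ring
  containing the constants and, by \<open>leading_variable_congruent\<close>, the variables in
  \<open>A_tau n l \<tau>\<close>. With \<open>\<tau>\<close> infinite this serves the elimination
  ideal, with \<open>\<tau>\<close> the orders of a given polynomial it serves
  \<open>I_ideal\<close>.\<close>

lemma eval_zeta_zero_in_ideal:
  assumes gs: "generic_system n l M" and V: "V_tau n l M \<tau> \<subseteq> V"
    and I: "ideal I (laurent_ring (carrier (QA_ring n l \<tau>)) V)" and PS: "PS n l M \<tau> \<subseteq> I"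
    and H: "mvars H \<subseteq> A_tau n l \<tau>" "eval_zeta l M H = 0"
  shows "mconst H \<in> I"
proof -
  let ?B = "{p :: dpoly. mvars p \<subseteq> A_tau n l \<tau>}"
  let ?L = "laurent_set ?B V"
  have carr: "carrier (QA_ring n l \<tau>) = ?B" by (simp add: QA_ring_def carrier_poly_ring)
  have B: "subring_set ?B" by (rule subring_set_mvars)
  interpret L: subring_set ?L by (rule subring_set_laurent_set[OF B])
  have I': "ideal I (subring_on ?L)" using I by (simp add: carr laurent_ring_eq)
  note ID = ideal_subring_onD[OF I']
  \<comment> \<open>Membership of \<open>mconst p\<close> in the ring is carried along because the
    congruence for a product multiplies an element of \<open>I\<close> by
    \<open>mconst a\<close>.\<close>
  define S where "S = {p. mconst p \<in> ?L \<and> mconst p - eval_zeta l M p \<in> I}"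
  have SD: "mconst p \<in> ?L" "mconst p - eval_zeta l M p \<in> I" if "p \<in> S" for p
    using that unfolding S_def by auto
  have SI: "p \<in> S" if "mconst p \<in> ?L" "mconst p - eval_zeta l M p = q" "q \<in> I" for p q
    using that unfolding S_def by auto
  have mconst_L: "mconst p \<in> ?L" if "mvars p \<subseteq> A_tau n l \<tau>" for p
    unfolding mconst_def using that by (intro laurent_set_single) auto
  have "meval mconst mvar H \<in> S"
  proof (rule meval_closed)
    fix a b assume a: "a \<in> S" and b: "b \<in> S"
    show "a + b \<in> S"
    proof (rule SI)
      show "mconst (a + b) \<in> ?L" unfolding mconst_add by (intro L.add SD a b)
      show "mconst (a + b) - eval_zeta l M (a + b) =
          (mconst a - eval_zeta l M a) + (mconst b - eval_zeta l M b)"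
        by (simp add: mconst_add eval_zeta_simps(3))
      show "(mconst a - eval_zeta l M a) + (mconst b - eval_zeta l M b) \<in> I"
        by (intro ID(3) SD a b)
    qed
    \<comment> \<open>The value of \<open>b\<close> differs from \<open>mconst b\<close> by an
      element of \<open>I\<close>, so it lies in the ring too and may multiply elements of
      \<open>I\<close>.\<close>
    have "mconst b - (mconst b - eval_zeta l M b) \<in> ?L"
      by (intro L.diff SD b subsetD[OF ID(1)])
    then have ev: "eval_zeta l M b \<in> ?L" by simp
    show "a * b \<in> S"
    proof (rule SI)
      show "mconst (a * b) \<in> ?L" unfolding mconst_mult by (intro L.mult SD a b)
      show "mconst (a * b) - eval_zeta l M (a * b) =
          mconst a * (mconst b - eval_zeta l M b) + (mconst a - eval_zeta l M a) * eval_zeta l M b"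
        unfolding mconst_mult eval_zeta_simps(4) by (simp add: algebra_simps)
      show "mconst a * (mconst b - eval_zeta l M b) + (mconst a - eval_zeta l M a) * eval_zeta l M b \<in> I"
        by (rule ID(3)[OF ID(4)[OF SD(2)[OF b] SD(1)[OF a]] ID(5)[OF SD(2)[OF a] ev]])
    qed
  next
    fix v assume "v \<in> mvars H"
    then have vA: "v \<in> A_tau n l \<tau>" using H by auto
    then obtain i k m where v: "v = Der (AI i k) m" "i \<in> {1..n}" "ereal (real m) \<le> \<tau> i"
      unfolding A_tau_def A_set_def by blast
    show "mvar v \<in> S"
    proof (rule SI)
      show "mconst (mvar v) \<in> ?L" by (rule mconst_L) (simp add: vA)
      show "mconst (mvar v) - eval_zeta l M (mvar v) = mconst (mvar v) - zeta_var l M v"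
        by (simp only: eval_zeta_mvar)
      show "mconst (mvar v) - zeta_var l M v \<in> I"
      proof (cases "k = 0")
        case True
        have "range mconst \<subseteq> ?B" by auto
        from leading_variable_congruent[of n l M i m \<tau>, OF gs v(2,3) B this V I[unfolded carr] PS]
        show ?thesis using True by (simp add: zeta_var_def v(1))
      qed (simp add: zeta_var_def v(1) ID(2))
    qed
  next
    show "mconst c \<in> S" for c
      by (rule SI[OF _ _ ID(2)]) (simp_all add: mconst_L eval_zeta_mconst)
    show "0 \<in> S" "1 \<in> S"
      by (rule SI[OF _ _ ID(2)], simp_all only: mconst_0 mconst_1 L.zero L.one eval_zeta_simps(1,2) diff_self)+
  qed
  then have "mconst H - eval_zeta l M H \<in> I" unfolding meval_id by (rule SD)
  then show ?thesis using H(2) by simp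
qed

section \<open>Elimination ideal and resultant\<close>

lemma mvars_dp_deriv:
  fixes p :: "('x der, 'a::comm_ring_1) mpoly"
  assumes "mvars p \<subseteq> ders X"
  shows "mvars (dp_deriv p) \<subseteq> ders X"
proof -
  interpret subring_set "{p :: ('x der, 'a::comm_ring_1) mpoly. mvars p \<subseteq> ders X}"
    by (rule subring_set_mvars)
  have "Poly_Mapping.keys (m - Poly_Mapping.single v 1 + Poly_Mapping.single (shift v) 1) \<subseteq> ders X"
    if "m \<in> Poly_Mapping.keys p" "v \<in> Poly_Mapping.keys m" for m v
  proof -
    have "Poly_Mapping.keys m \<subseteq> ders X" using assms that by (auto simp: mvars_def)
    moreover have "shift v \<in> ders X" using calculation that by (cases v) (auto simp: ders_def)
    moreover have "Poly_Mapping.keys (m - Poly_Mapping.single v 1 + Poly_Mapping.single (shift v) 1) \<subseteq>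
        Poly_Mapping.keys m \<union> {shift v}"
      by (auto simp: in_keys_iff lookup_add lookup_minus lookup_single when_def split: if_splits)
    ultimately show ?thesis by blast
  qed
  then have "mvars (Poly_Mapping.single (m - Poly_Mapping.single v 1 + Poly_Mapping.single (shift v) 1) c) \<subseteq> ders X"
    if "m \<in> Poly_Mapping.keys p" "v \<in> Poly_Mapping.keys m" for m v and c :: 'a
    using that by (auto simp: mvars_def)
  then have "dp_deriv p \<in> {p. mvars p \<subseteq> ders X}"
    unfolding dp_deriv_def by (intro sum_closed add zero) auto
  then show ?thesis by simp
qed

lemma eval_zeta_laurent_FF: "eval_zeta_laurent l M (FF l M i) = 0"
proof -
  have "{..l i} = insert 0 {1..l i}" by auto
  then show ?thesis
    unfolding FF_def eval_zeta_laurent_sum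
    by (simp add: eval_zeta_laurent_single eval_zeta_mvar zeta_var_def zeta_def mconst_def
        sum_distrib_left mult_single)
qed

lemma carrier_D_ring: "carrier (D_ring n l) = {p. mvars p \<subseteq> ders (A_all n l)}"
  by (simp add: D_ring_def carrier_poly_ring)

text \<open>The kernel \<open>K\<close> of \<open>eval_zeta_laurent\<close> is a differential ideal
  containing the system, hence contains the one generated by it.\<close>

lemma eval_zeta_elim_ideal:
  assumes gs: "generic_system n l M" and f: "f \<in> elim_ideal n l M"
  shows "eval_zeta l M f = 0"
proof -
  let ?B = "carrier (D_ring n l)"
  define V where "V = ders {1..n-1}"
  have B: "subring_set ?B" unfolding carrier_D_ring by (rule subring_set_mvars)
  interpret B: subring_set ?B by (rule B)
  interpret L: subring_set "laurent_set ?B V" by (rule subring_set_laurent_set[OF B])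
  define K where "K = {g \<in> laurent_set ?B V. eval_zeta_laurent l M g = 0}"
  have "ideal K (DU_ring n l)"
    unfolding DU_ring_def laurent_ring_eq V_def[symmetric]
    by (rule L.ideal_subring_onI)
      (auto simp: K_def L.zero L.add L.mult eval_zeta_laurent_add eval_zeta_laurent_mult)
  moreover have "ld_deriv ` K \<subseteq> K"
  proof
    fix h assume "h \<in> ld_deriv ` K"
    then obtain g where g: "h = ld_deriv g" "g \<in> laurent_set ?B V" "eval_zeta_laurent l M g = 0"
      by (auto simp: K_def)
    have "shift ` V \<subseteq> V" by (auto simp: V_def ders_def)
    moreover have "dp_deriv ` ?B \<subseteq> ?B" using mvars_dp_deriv by (auto simp: carrier_D_ring)
    ultimately have "h \<in> laurent_set ?B V"
      unfolding g(1) by (intro ld_deriv_laurent_set[OF B _ subset_refl _ g(2)])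
    then show "h \<in> K"
      using g(3) by (simp add: K_def g(1) eval_zeta_laurent_ld_deriv derivationD(3)[OF derivation_ld_deriv])
  qed
  moreover have "PP n l M \<subseteq> K"
  proof
    fix F assume "F \<in> PP n l M"
    then obtain i where i: "i \<in> {1..n}" "F = FF l M i" by (auto simp: PP_def)
    have "F \<in> laurent_set ?B V"
      unfolding i(2) FF_def
    proof (intro sum_closed L.zero L.add laurent_set_single B.zero)
      fix k assume "k \<in> {..l i}"
      then show "mvar (Der (AI i k) 0) \<in> ?B" "Poly_Mapping.keys (M i k) \<subseteq> V"
        using gs i(1) by (auto simp: V_def carrier_D_ring ders_def A_all_def A_set_def generic_system_def)
    qed
    then show "F \<in> K" using eval_zeta_laurent_FF i(2) by (simp add: K_def)
  qed
  ultimately have "mconst f \<in> K"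
    using f by (auto simp: elim_ideal_def gen_diff_ideal_def diff_ideal_def)
  then show ?thesis by (simp add: K_def eval_zeta_laurent_mconst)
qed

lemma zero_of_zeta_in_elim_ideal:
  assumes gs: "generic_system n l M" and H: "H \<in> carrier (D_ring n l)" "eval_zeta l M H = 0"
  shows "H \<in> elim_ideal n l M"
proof -
  \<comment> \<open>Infinite orders impose no bound, so the coefficient ring becomes all of
    \<open>D_ring n l\<close>.\<close>
  have A: "A_tau n l (\<lambda>_. \<infinity>) = ders (A_all n l)"
    by (auto simp: A_tau_def ders_def A_all_def)
  then have Q: "QA_ring n l (\<lambda>_. \<infinity>) = D_ring n l" by (simp add: QA_ring_def D_ring_def)
  have "mconst H \<in> I" if I: "diff_ideal I (DU_ring n l) ld_deriv" "PP n l M \<subseteq> I" for I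
  proof (rule eval_zeta_zero_in_ideal[OF gs, where \<tau> = "\<lambda>_. \<infinity>"])
    show "V_tau n l M (\<lambda>_. \<infinity>) \<subseteq> ders {1..n-1}" by (auto simp: V_tau_def ders_def)
    show "ideal I (laurent_ring (carrier (QA_ring n l (\<lambda>_. \<infinity>))) (ders {1..n-1}))"
      using I(1) by (simp add: Q diff_ideal_def DU_ring_def)
    have "(ld_deriv ^^ k) (FF l M i) \<in> I" if "i \<in> {1..n}" for k i
      using I that by (induction k) (auto simp: diff_ideal_def PP_def)
    then show "PS n l M (\<lambda>_. \<infinity>) \<subseteq> I" by (auto simp: PS_def)
    show "mvars H \<subseteq> A_tau n l (\<lambda>_. \<infinity>)" using H(1) by (simp add: A carrier_D_ring)
  qed (rule H(2))
  then show ?thesis using H(1) by (simp add: elim_ideal_def gen_diff_ideal_def)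
qed

section \<open>Rankings, leaders and Ritt reduction\<close>

lemma funpow_shift: "(shift ^^ k) (Der x m) = Der x (m + k)"
  by (induction k) auto

lemma deg_in_eq_0: "v \<notin> mvars p \<Longrightarrow> deg_in v p = 0"
  unfolding deg_in_def by (intro Max_eqI) (auto simp: mvars_def in_keys_iff)

lemma deg_in_0 [simp]: "deg_in v 0 = 0"
  by (rule deg_in_eq_0) simp

text \<open>Compare indeterminates first, by an injective numbering that gives \<open>a\<close> the
  top value \<open>N\<close>, and orders of derivation second. Above a derivative of
  \<open>a\<close> there are then only derivatives of \<open>a\<close>.\<close>

lemma exists_elim_ranking:
  assumes "finite X" "a \<in> X"
  obtains r where "elim_ranking X r" "\<And>k w. (Der a k, w) \<in> r \<Longrightarrow> \<exists>m\<ge>k. w = Der a m"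
proof -
  obtain f :: "'a \<Rightarrow> nat" and N where f: "f ` X = {i. i < N}" "inj_on f X"
    using finite_imp_inj_to_nat_seg[OF assms(1)] by auto
  define g where "g x = (if x = a then N else f x)" for x
  have g: "inj_on g X" using f by (auto simp: g_def inj_on_def)
  have "f x < N" if "x \<in> X" for x using f(1) that by blast
  then have ga: "g x \<le> g a" if "x \<in> X" for x using that by (simp add: g_def less_imp_le)
  define r where "r = {(Der x k, Der y m) | x y k m. x \<in> X \<and> y \<in> X \<and> (g x < g y \<or> (x = y \<and> k \<le> m))}"
  have r: "(Der x k, Der y m) \<in> r \<longleftrightarrow> x \<in> X \<and> y \<in> X \<and> (g x < g y \<or> (x = y \<and> k \<le> m))" for x y k m
    by (auto simp: r_def)
  have "refl_on (ders X) r" by (auto simp: refl_on_def ders_def r_def)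
  moreover have "r \<subseteq> ders X \<times> ders X" by (auto simp: ders_def r_def)
  moreover have "trans r" by (auto simp: trans_def r_def)
  moreover have "antisym r" by (auto simp: antisym_def r_def)
  moreover have "total_on (ders X) r"
    unfolding total_on_def
  proof (intro ballI impI)
    fix v w assume "v \<in> ders X" "w \<in> ders X" "v \<noteq> w"
    then obtain x k y m where "v = Der x k" "w = Der y m" "x \<in> X" "y \<in> X" "x \<noteq> y \<or> k \<noteq> m"
      by (auto simp: ders_def)
    then show "(v, w) \<in> r \<or> (w, v) \<in> r"
      using inj_on_eq_iff[OF g, of x y] by (auto simp: r)
  qed
  ultimately have "linear_order_on (ders X) r"
    by (simp add: linear_order_on_def partial_order_on_def preorder_on_def)
  then have "ranking X r"
    by (auto simp: ranking_def ders_def r_def)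
  then have "elim_ranking X r" by (auto simp: elim_ranking_def r)
  moreover have "\<exists>m\<ge>k. w = Der a m" if "(Der a k, w) \<in> r" for k w
    using that ga by (cases w) (force simp: r)
  ultimately show thesis using that by blast
qed

lemma linear_order_finite_max:
  assumes "linear_order_on A r" "finite S" "S \<noteq> {}" "S \<subseteq> A"
  shows "\<exists>v\<in>S. \<forall>w\<in>S. (w, v) \<in> r"
  using assms(2-4)
proof (induction S rule: finite_ne_induct)
  case (singleton x)
  then show ?case using assms(1) by (auto simp: order_on_defs refl_on_def)
next
  case (insert x S)
  then obtain v where v: "v \<in> S" "\<forall>w\<in>S. (w, v) \<in> r" by auto
  have tr: "trans r" and rf: "(x, x) \<in> r" and tot: "(x, v) \<in> r \<or> (v, x) \<in> r"
    using assms(1) insert v by (auto simp: order_on_defs refl_on_def total_on_def)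
  from tot show ?case
  proof
    assume "(v, x) \<in> r"
    then have "\<forall>w\<in>insert x S. (w, x) \<in> r" using v rf transD[OF tr] by blast
    then show ?thesis by blast
  qed (use v in auto)
qed

text \<open>A finite nonempty set of variables has a greatest element, unique by antisymmetry, so
  the description in \<open>leader\<close> denotes it.\<close>

lemma leader_greatest:
  assumes "ranking X r" "mvars R \<subseteq> ders X" "mvars R \<noteq> {}"
  shows "leader r R \<in> mvars R" "w \<in> mvars R \<Longrightarrow> (w, leader r R) \<in> r"
proof -
  have lin: "linear_order_on (ders X) r" using assms(1) by (simp add: ranking_def)
  then have "antisym r" by (auto simp: order_on_defs)
  obtain v where v: "v \<in> mvars R" "\<forall>w\<in>mvars R. (w, v) \<in> r"
    using linear_order_finite_max[OF lin finite_mvars assms(3,2)] by blast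
  have "leader r R = v"
    unfolding leader_def by (rule the_equality) (use v \<open>antisym r\<close> in \<open>auto dest: antisymD\<close>)
  then show "leader r R \<in> mvars R" "w \<in> mvars R \<Longrightarrow> (w, leader r R) \<in> r" using v by auto
qed

lemma ranking_funpow_shift:
  assumes r: "ranking X r" and v: "v \<in> ders X"
  shows "(v, (shift ^^ k) v) \<in> r"
proof (induction k)
  case 0
  then show ?case using r v by (auto simp: ranking_def order_on_defs refl_on_def)
next
  case (Suc k)
  have "(shift ^^ k) v \<in> ders X" using v by (cases v) (auto simp: ders_def funpow_shift)
  then have "((shift ^^ k) v, (shift ^^ Suc k) v) \<in> r" using r by (simp add: ranking_def)
  then show ?case using Suc r by (auto simp: ranking_def order_on_defs elim: transD)
qed

text \<open>That \<open>0\<close> is reduced is not vacuous: with the Ritt steps used here it says that \<open>\<partial>\<^sup>k R\<close> has positive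
  degree in \<open>\<partial>\<^sup>k \<theta>\<close>, \<open>\<theta>\<close> the leader of \<open>R\<close>.\<close>

lemma diff_remainder_self:
  assumes r: "ranking X r" and R: "mvars R \<subseteq> ders X" "mvars R \<noteq> {}" and red: "diff_reduced r R 0"
  shows "diff_remainder r R R 0"
proof -
  let ?v = "leader r R"
  have v: "?v \<in> ders X" using leader_greatest(1)[OF r R] R by auto
  \<comment> \<open>A proper derivative of the leader ranks strictly above it and cannot occur in
    \<open>R\<close>. So \<open>R\<close> has degree 0 there, like the polynomial 0, and is not
    reducible because 0 is not.\<close>
  have "\<not> reducible_at r R k R" if "0 < k" for k
  proof -
    have "(shift ^^ k) ?v \<notin> mvars R"
    proof
      assume "(shift ^^ k) ?v \<in> mvars R"
      then have "((shift ^^ k) ?v, ?v) \<in> r" by (rule leader_greatest(2)[OF r R])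
      then have "(shift ^^ k) ?v = ?v"
        using ranking_funpow_shift[OF r v, of k] r by (auto simp: ranking_def order_on_defs dest: antisymD)
      then show False using that by (cases "?v") (simp add: funpow_shift)
    qed
    then show ?thesis
      using red by (simp add: diff_reduced_def reducible_at_def Let_def deg_in_eq_0)
  qed
  \<comment> \<open>At \<open>k = 0\<close> the divisor is \<open>R\<close> itself: the leading
    coefficients agree, the power of the leader is 0, and the difference is 0.\<close>
  then have "ritt_step r R R 0"
    unfolding ritt_step_def by (intro exI[of _ 0]) (auto simp: reducible_at_def Let_def)
  then show ?thesis using red by (auto simp: diff_remainder_def)
qed

text \<open>The reduction has a first step, since \<open>H\<close> is nonzero. As 0 is reduced, the
  derivative of \<open>R\<close> used in that step has positive degree in the corresponding
  derivative of the leader, and \<open>H\<close> has at least this degree.\<close>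

lemma diff_remainder_order:
  assumes rem: "diff_remainder r R H 0" and "H \<noteq> 0"
  obtains k where "(shift ^^ k) (leader r R) \<in> mvars H"
proof -
  have "(ritt_step r R)\<^sup>*\<^sup>* H 0" using rem by (simp add: diff_remainder_def)
  then obtain H' where "ritt_step r R H H'" using \<open>H \<noteq> 0\<close> by (metis converse_rtranclpE)
  then obtain k where k: "reducible_at r R k H" unfolding ritt_step_def by blast
  moreover have "\<not> reducible_at r R k 0" using rem by (simp add: diff_remainder_def diff_reduced_def)
  ultimately have "deg_in ((shift ^^ k) (leader r R)) H \<noteq> 0"
    by (simp add: reducible_at_def Let_def)
  then have "(shift ^^ k) (leader r R) \<in> mvars H" using deg_in_eq_0[of "(shift ^^ k) (leader r R)" H] by argo
  then show thesis by (rule that)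
qed

text \<open>Rank \<open>a\<close> highest: a reduction of \<open>H\<close> to \<open>0\<close> must start with a derivative of the leader of \<open>R\<close>,
  which is a derivative of \<open>a\<close>.\<close>

lemma sat_ideal_order:
  assumes R: "mvars R \<subseteq> ders (A_all n l)" and H: "H \<in> sat_ideal n l R" "H \<noteq> 0"
    and a: "a \<in> A_all n l" "Der a k \<in> mvars R"
  shows "\<exists>m\<ge>k. Der a m \<in> mvars H"
proof -
  have "finite (A_all n l)" by (auto simp: A_all_def A_set_def)
  then obtain r where r: "elim_ranking (A_all n l) r"
    "\<And>k w. (Der a k, w) \<in> r \<Longrightarrow> \<exists>m\<ge>k. w = Der a m"
    using exists_elim_ranking[OF _ a(1)] by blast
  have "(Der a k, leader r R) \<in> r"
    by (rule leader_greatest(2)) (use r(1) R a in \<open>auto simp: elim_ranking_def\<close>)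
  then obtain m where m: "m \<ge> k" "leader r R = Der a m" using r(2) by blast
  have "diff_remainder r R H 0" using H r(1) by (simp add: sat_ideal_def)
  then obtain k' where "(shift ^^ k') (leader r R) \<in> mvars H" by (rule diff_remainder_order[OF _ H(2)])
  then have "Der a (m + k') \<in> mvars H" by (simp add: m funpow_shift)
  then show ?thesis using m(1) by (meson le_add1 order_trans)
qed

text \<open>Any member \<open>H\<close> certifies that 0 is reduced with respect to \<open>R\<close>
  under every elimination ranking, which \<open>diff_remainder_self\<close> requires.\<close>

lemma self_in_sat_ideal:
  assumes R: "R \<in> carrier (D_ring n l)" "mvars R \<noteq> {}" and H: "H \<in> sat_ideal n l R"
  shows "R \<in> sat_ideal n l R"
proof -
  have "diff_remainder r R R 0" if r: "elim_ranking (A_all n l) r" for r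
  proof (rule diff_remainder_self)
    show "ranking (A_all n l) r" using r by (simp add: elim_ranking_def)
    show "mvars R \<subseteq> ders (A_all n l)" using R(1) by (simp add: carrier_D_ring)
    have "diff_remainder r R H 0" using H r unfolding sat_ideal_def by blast
    then show "diff_reduced r R 0" unfolding diff_remainder_def ..
  qed (rule R(2))
  then show ?thesis using R(1) unfolding sat_ideal_def by blast
qed

text \<open>Applied to the resultant, whose order in each single indeterminate is bounded by that of
  \<open>H\<close>, and to \<open>H\<close> against its own orders.\<close>

lemma mvars_subset_A_tau:
  assumes R: "mvars R \<subseteq> ders (A_all n l)"
    and ord: "\<And>a k. a \<in> A_all n l \<Longrightarrow> Der a k \<in> mvars R \<Longrightarrow> \<exists>m\<ge>k. Der a m \<in> mvars H"
  shows "mvars R \<subseteq> A_tau n l (ord_A l H)"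
proof
  fix v assume v: "v \<in> mvars R"
  then have "v \<in> ders (A_all n l)" using R by blast
  then obtain a k where ak: "v = Der a k" "a \<in> A_all n l" unfolding ders_def by blast
  then obtain i where "i \<in> {1..n}" "a \<in> A_set l i" unfolding A_all_def by blast
  note vak = ak(1) this ak(2)
  then obtain m where m: "k \<le> m" "Der a m \<in> mvars H" using ord v by blast
  have "ereal (real k) \<le> ord_A l H i"
    unfolding ord_A_def by (rule SUP_upper2[of m]) (use vak m in auto)
  then show "v \<in> A_tau n l (ord_A l H)" using vak by (auto simp: A_tau_def)
qed

text \<open>The generated ideal is the intersection of all ideals containing \<open>PS\<close>, and
  \<open>eval_zeta_zero_in_ideal\<close> applies to each of them.\<close>

lemma zero_of_zeta_in_I_ideal:
  assumes gs: "generic_system n l M" and f: "mvars f \<subseteq> A_tau n l (ord_A l H)" "eval_zeta l M f = 0"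
  shows "f \<in> I_ideal n l M H"
  unfolding I_ideal_def Let_def genideal_def
  using eval_zeta_zero_in_ideal[OF gs subset_refl _ _ f] f(1)
  by (auto simp: QA_ring_def carrier_poly_ring)

theorem theorem6p17:
  fixes n :: nat and l :: "nat \<Rightarrow> nat" and M :: "nat \<Rightarrow> nat \<Rightarrow> umonom"
    and \<rho> :: "nat \<Rightarrow> ldpoly" and \<upsilon> :: "'y::finite \<Rightarrow> nat der"
    and A :: "nat \<Rightarrow> (int ^ 'y) set"
    and l\<^sub>0 :: nat and \<omega> :: "nat \<Rightarrow> real ^ 'y" and \<delta> :: "real ^ 'y" and ro :: "(nat \<times> nat) set"
    and H\<^sub>0 R :: dpoly
  assumes "generic_system n l M"
    and "diff_essential n l M"
    and "super_essential n l M"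
    and "bij_betw \<rho> {1..Lnum n l M} (ps n l M)"
    and "bij_betw \<upsilon> UNIV (VV n l M)"
    and "distinguished_coeffs n l M \<rho> \<upsilon>"
    and "A = (\<lambda>h. supp_y \<upsilon> (\<rho> h))"
    and "generic_lifting (Lnum n l M) A \<omega>"
    and "generic_shift (Lnum n l M) A \<omega> \<delta>"
    and "l\<^sub>0 \<in> {1..Lnum n l M}"
    and "linear_order_on {1..Lnum n l M} ro"
    and "\<forall>h\<in>{1..Lnum n l M}. (l\<^sub>0, h) \<in> ro"
    and "sylv_det (Lnum n l M) A \<omega> \<delta> ro \<noteq> 0"
    and "spec_output (C_set (Lnum n l M) A) (Xi \<rho> \<upsilon>) (sylv_det (Lnum n l M) A \<omega> \<delta> ro) H\<^sub>0"
    and "is_diff_res n l M R"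
    and "\<exists>H\<in>zeta_factors n l M H\<^sub>0.
           codimension (QA_ring n l (ord_A l H)) (I_ideal n l M H) = 1"
  shows "\<exists>\<EE>\<in>carrier (D_ring n l). H\<^sub>0 = \<EE> * R"
proof -
  note gs = assms(1)
  have R: "mvars R \<subseteq> ders (A_all n l)" "R \<in> carrier (D_ring n l)" and elim: "elim_ideal n l M = sat_ideal n l R"
    and irrR: "Factorial_Ring.irreducible R"
    using assms(15) ring_irreducible_poly_ring[of R "ders (A_all n l)"]
    by (auto simp: is_diff_res_def carrier_D_ring D_ring_def carrier_poly_ring)
  obtain H where H: "H \<in> zeta_factors n l M H\<^sub>0"
    and codim: "codimension (QA_ring n l (ord_A l H)) (I_ideal n l M H) = 1"
    using assms(16) by blast
  have HD: "H \<in> carrier (D_ring n l)" and Hv: "mvars H \<subseteq> ders (A_all n l)" and zH: "eval_zeta l M H = 0"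
    and dvd: "H divides\<^bsub>D_ring n l\<^esub> H\<^sub>0" and irrH: "Factorial_Ring.irreducible H"
    using H ring_irreducible_poly_ring[of H "ders (A_all n l)"]
    by (auto simp: zeta_factors_def carrier_D_ring D_ring_def carrier_poly_ring)
  have "mvars R \<noteq> {}"
    using irrR mpoly_unit_iff[of R] unfolding Factorial_Ring.irreducible_def by blast
  \<comment> \<open>This membership is used twice: it certifies that 0 is reduced, which puts
    \<open>R\<close> into its own saturation, and it bounds the orders of \<open>R\<close> by those
    of \<open>H\<close>.\<close>
  have Hsat: "H \<in> sat_ideal n l R" using zero_of_zeta_in_elim_ideal[OF gs HD zH] elim by simp
  have "R \<in> elim_ideal n l M"
    using self_in_sat_ideal[OF R(2) \<open>mvars R \<noteq> {}\<close> Hsat] elim by simp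
  then have zR: "eval_zeta l M R = 0" by (rule eval_zeta_elim_ideal[OF gs])
  have "mvars H \<subseteq> A_tau n l (ord_A l H)" by (rule mvars_subset_A_tau[OF Hv]) blast
  then have HI: "H \<in> I_ideal n l M H" using zero_of_zeta_in_I_ideal[OF gs _ zH] by blast
  have "H \<noteq> 0" using irrH by auto
  then have "mvars R \<subseteq> A_tau n l (ord_A l H)"
    using sat_ideal_order[OF R(1) Hsat] by (intro mvars_subset_A_tau[OF R(1)])
  then have RI: "R \<in> I_ideal n l M H" using zero_of_zeta_in_I_ideal[OF gs _ zR] by blast
  have "H dvd R" using codimension_one_dvd[OF irrH codim[unfolded QA_ring_def] HI RI] .
  then obtain s where s: "R = H * s" by (rule dvdE)
  \<comment> \<open>\<open>H\<close> is no unit, so irreducibility of \<open>R\<close> makes the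
    cofactor a unit. With \<open>e\<close> its inverse and \<open>q\<close> the cofactor of
    \<open>H\<close> in \<open>H\<^sub>0\<close>, the factor sought is \<open>e * q\<close>; the
    unit \<open>e\<close> is constant and adds no variable.\<close>
  then have "s dvd 1" using irrR irrH unfolding Factorial_Ring.irreducible_def by blast
  then obtain e where e: "1 = s * e" by (rule dvdE)
  obtain q where q: "mvars q \<subseteq> ders (A_all n l)" "H\<^sub>0 = H * q"
    using dvd by (auto simp: factor_def D_ring_def poly_ring_def subring_on_def)
  have "e dvd 1" using e by (metis dvd_triv_right)
  then have "mvars (e * q) \<subseteq> ders (A_all n l)" using mpoly_unit_iff[of e] mvars_mult[of e q] q by auto
  moreover have "H\<^sub>0 = (e * q) * R"
  proof -
    have "H\<^sub>0 = (s * e) * (H * q)" using q e by simp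
    then show ?thesis unfolding s by (simp only: mult_ac)
  qed
  ultimately show ?thesis by (auto simp: carrier_D_ring)
qed

end
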